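(* Each of the ten atomic-flow reduction rules $\mathsf{w}{\downarrow}$-$\mathsf{c}{\downarrow}$, $\mathsf{w}{\downarrow}$-$\mathsf{i}{\uparrow}$, $\mathsf{w}{\downarrow}$-$\mathsf{w}{\uparrow}$, $\mathsf{w}{\downarrow}$-$\mathsf{c}{\uparrow}$, $\mathsf{c}{\downarrow}$-$\mathsf{i}{\uparrow}$, $\mathsf{c}{\downarrow}$-$\mathsf{c}{\uparrow}$, $\mathsf{c}{\uparrow}$-$\mathsf{w}{\uparrow}$, $\mathsf{i}{\downarrow}$-$\mathsf{w}{\uparrow}$, $\mathsf{c}{\downarrow}$-$\mathsf{w}{\uparrow}$ and $\mathsf{i}{\downarrow}$-$\mathsf{c}{\uparrow}$ is sound: for each such rule $r$, whenever $C\to_r D$ and $\Phi$ is an $\mathsf{SKS}$ derivation with associated atomic flow $C$, there is an $\mathsf{SKS}$ derivation $\Psi$ with associated atomic flow $D$ and with the same premiss and conclusion as $\Phi$.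
   Context: Formulae are built from the units $\mathsf f$ and $\mathsf t$, atoms, disjunction $[\alpha\vee\beta]$ and conjunction $(\alpha\wedge\beta)$; on atoms there is an involution $a\mapsto\bar a$ with $\bar a\neq a$. An inference step of a rule $\alpha/\beta$ rewrites $\xi\{\alpha\}$ into $\xi\{\beta\}$ for an arbitrary context (formula with a hole) $\xi$. A derivation from $\alpha$ (premiss) to $\beta$ (conclusion) is a finite chain of steps from $\alpha$ to $\beta$. System $\mathsf{SKS}$: interaction $\mathsf t/[a\vee\bar a]$; weakening $\mathsf f/a$; contraction $[a\vee a]/a$; cut $(a\wedge\bar a)/\mathsf f$; coweakening $a/\mathsf t$; cocontraction $a/(a\wedge a)$; switch $(\alpha\wedge[\beta\vee\gamma])/[(\alpha\wedge\beta)\vee\gamma]$; medial $[(\alpha\wedge\beta)\vee(\gamma\wedge\delta)]/([\alpha\vee\gamma]\wedge[\beta\vee\delta])$; and $\gamma/\delta$ whenever $\gamma=\delta$ is (either direction of) an instance of commutativity or associativity of $\vee,\wedge$, $[\alpha\vee\mathsf f]=\alpha$, $(\alpha\wedge\mathsf t)=\alpha$, $[\mathsf t\vee\mathsf t]=\mathsf t$, $(\mathsf f\wedge\mathsf f)=\mathsf f$. An atomic flow is a tuple $(V,E,\eta,up,lo)$: finite vertex and edge sets, a labelling of vertices by interaction, cut, weakening, coweakening, contraction, cocontraction, and maps $up:E\to V\cup\{\top\}$, $lo:E\to V\cup\{\bot\}$. Upper edges of $\nu$: $lo(\epsilon)=\nu$; lower edges: $up(\epsilon)=\nu$. (Upper,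 lower) edge numbers: $(0,2)$ interaction, $(2,0)$ cut, $(0,1)$ weakening, $(1,0)$ coweakening, $(2,1)$ contraction, $(1,2)$ cocontraction; no directed cycles; a sign map $\pi:E\to\{+,-\}$ exists giving all edges of a (co)contraction the same sign and the two edges of an interaction/cut different signs. The atomic flow of an $\mathsf{SKS}$ derivation traces atom occurrences: occurrences in contexts and instantiated subformulae of switch, medial, $=$ keep their edge through a step; each step of an atomic rule gives a vertex with that label whose upper edges are the redex occurrences of the step's premiss and lower edges those of its conclusion; occurrences in the premiss/conclusion of the derivation have $up=\top$ / $lo=\bot$. For a rule $r$, $C\to_r D$ means that the left-hand pattern of $r$ occurs in flow $C$ and $D$ is obtained by replacing it by the right-hand pattern, all other vertices and edges unchanged. The rules: $\mathsf{w}{\downarrow}$-$\mathsf{c}{\downarrow}$: a weakening whose lower edge is an upper edge of a contraction; delete both vertices and that edge, merging the contraction's other upper edge and its lower edge into a single edge. $\mathsf{c}{\uparrow}$-$\mathsf{w}{\uparrow}$: a coweakening whose upper edge is a lower edge of a cocontraction; delete both, merging the cocontraction's upper edge and its other lower edge. $\mathsf{w}{\downarrow}$-$\mathsf{i}{\uparrow}$: a weakening whose lower edge is an upper edge of a cut; delete both, the cut's other upper edge becoming the upper edge of a new coweakening. $\mathsf{i}{\downarrow}$-$\mathsf{w}{\uparrow}$: an interaction one of whose lower edges is the upper edge of a coweakening; delete both, the interaction's other lower edge becoming the lower edge of a new weakening. $\mathsf{w}{\downarrow}$-$\mathsf{w}{\uparrow}$: an edge from a weakening to a coweakening; delete the edge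 and both vertices. $\mathsf{w}{\downarrow}$-$\mathsf{c}{\uparrow}$: a weakening whose lower edge is the upper edge of a cocontraction with lower edges $\epsilon_1,\epsilon_2$; replace by two new weakenings with lower edges $\epsilon_1$ and $\epsilon_2$. $\mathsf{c}{\downarrow}$-$\mathsf{w}{\uparrow}$: a coweakening whose upper edge is the lower edge of a contraction with upper edges $\epsilon_1,\epsilon_2$; replace by two new coweakenings with upper edges $\epsilon_1$ and $\epsilon_2$. $\mathsf{c}{\downarrow}$-$\mathsf{i}{\uparrow}$: a contraction with upper edges $\epsilon_1,\epsilon_2$ whose lower edge is an upper edge of a cut whose other upper edge is $\epsilon_3$; replace by a new cocontraction with upper edge $\epsilon_3$ and new lower edges $\delta_1,\delta_2$ and two new cuts with upper edges $\{\epsilon_1,\delta_1\}$ and $\{\epsilon_2,\delta_2\}$. $\mathsf{i}{\downarrow}$-$\mathsf{c}{\uparrow}$: an interaction with lower edges $\epsilon_3,\epsilon_4$, where $\epsilon_4$ is the upper edge of a cocontraction with lower edges $\epsilon_1,\epsilon_2$; replace by a new contraction with lower edge $\epsilon_3$ and new upper edges $\delta_1,\delta_2$ and two new interactions with lower edges $\{\epsilon_1,\delta_1\}$ and $\{\epsilon_2,\delta_2\}$. $\mathsf{c}{\downarrow}$-$\mathsf{c}{\uparrow}$: a contraction with upper edges $\epsilon_1,\epsilon_2$ whose lower edge is the upper edge of a cocontraction with lower edges $\epsilon_3,\epsilon_4$; replace by cocontractions $\kappa_1,\kappa_2$ with upper edges $\epsilon_1,\epsilon_2$, contractions $\gamma_3,\gamma_4$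 with lower edges $\epsilon_3,\epsilon_4$, and four new edges, one from each $\kappa_i$ to each $\gamma_j$. *)

theory Defs
  imports Main
begin

text \<open>Atoms have type 'a; the involution on atoms is a parameter bar with
  bar (bar a) = a and bar a \<noteq> a (assumed in the theorem).
  Every atom occurrence carries a label of type 'l, which names the edge
  of the atomic flow it belongs to (occurrence tracing).\<close>

datatype ('a, 'l) lform =
    Ff
  | Tt
  | At 'a 'l
  | Or "('a, 'l) lform" "('a, 'l) lform"
  | And "('a, 'l) lform" "('a, 'l) lform"

definition erase :: "('a, 'l) lform \<Rightarrow> ('a, unit) lform" where
  "erase \<phi> = map_lform id (\<lambda>_. ()) \<phi>"

fun labels :: "('a, 'l) lform \<Rightarrow> 'l list" where
  "labels Ff = []"
| "labels Tt = []"
| "labels (At a e) = [e]"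
| "labels (Or x y) = labels x @ labels y"
| "labels (And x y) = labels x @ labels y"

datatype ('a, 'l) ctx =
    Hole
  | OrL "('a, 'l) ctx" "('a, 'l) lform"
  | OrR "('a, 'l) lform" "('a, 'l) ctx"
  | AndL "('a, 'l) ctx" "('a, 'l) lform"
  | AndR "('a, 'l) lform" "('a, 'l) ctx"

fun plug :: "('a, 'l) ctx \<Rightarrow> ('a, 'l) lform \<Rightarrow> ('a, 'l) lform" where
  "plug Hole x = x"
| "plug (OrL c y) x = Or (plug c x) y"
| "plug (OrR y c) x = Or y (plug c x)"
| "plug (AndL c y) x = And (plug c x) y"
| "plug (AndR y c) x = And y (plug c x)"

datatype vkind = Iv \<comment> \<open>interaction\<close> | Cutv \<comment> \<open>cut\<close> | Wv
  | CoWv \<comment> \<open>coweakening\<close> | Cv \<comment> \<open>contraction\<close> | CoCv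

inductive eq_ax :: "('a, 'l) lform \<Rightarrow> ('a, 'l) lform \<Rightarrow> bool" where
  "eq_ax (Or x y) (Or y x)"
| "eq_ax (And x y) (And y x)"
| "eq_ax (Or (Or x y) z) (Or x (Or y z))"
| "eq_ax (And (And x y) z) (And x (And y z))"
| "eq_ax (Or x Ff) x"
| "eq_ax (And x Tt) x"
| "eq_ax (Or Tt Tt) Tt"
| "eq_ax (And Ff Ff) Ff"

text \<open>Non-atomic rules: switch, medial and the equations in both directions.
  Instantiated subformulae keep their labels.\<close>
inductive struct_ax :: "('a, 'l) lform \<Rightarrow> ('a, 'l) lform \<Rightarrow> bool" where
  switch: "struct_ax (And x (Or y z)) (Or (And x y) z)"
| medial: "struct_ax (Or (And x y) (And z w)) (And (Or x z) (Or y w))"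
| eq1: "eq_ax x y \<Longrightarrow> struct_ax x y"
| eq2: "eq_ax x y \<Longrightarrow> struct_ax y x"

text \<open>Atomic rules; the labels of the conclusion are the lower edges of the
  new vertex, those of the premiss its upper edges.\<close>
inductive atomic_ax :: "('a \<Rightarrow> 'a) \<Rightarrow> vkind \<Rightarrow> ('a, 'l) lform \<Rightarrow> ('a, 'l) lform \<Rightarrow> bool"
  for bar where
  interaction: "e1 \<noteq> e2 \<Longrightarrow> atomic_ax bar Iv Tt (Or (At a e1) (At (bar a) e2))"
| weakening: "atomic_ax bar Wv Ff (At a e)"
| contraction: "atomic_ax bar Cv (Or (At a e1) (At a e2)) (At a e3)"
| cut: "atomic_ax bar Cutv (And (At a e1) (At (bar a) e2)) Ff"
| coweakening: "atomic_ax bar CoWv (At a e) Tt"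
| cocontraction: "e1 \<noteq> e2 \<Longrightarrow> atomic_ax bar CoCv (At a e) (And (At a e1) (At a e2))"

text \<open>A derivation is a list of formulae f_0 .. f_n together with, for each
  step i (from f_i to f_(i+1)), None for a switch/medial/equation step and
  Some k for a step of atomic rule k.\<close>
type_synonym ('a, 'l) deriv = "('a, 'l) lform list \<times> vkind option list"

definition occ :: "('a, 'l) deriv \<Rightarrow> nat \<Rightarrow> 'l set" where
  "occ \<Phi> i = set (labels (fst \<Phi> ! i))"

definition is_deriv :: "('a \<Rightarrow> 'a) \<Rightarrow> ('a, 'l) deriv \<Rightarrow> bool" where
  "is_deriv bar \<Phi> \<longleftrightarrow>
     (let fs = fst \<Phi>; ks = snd \<Phi> in
       length fs = Suc (length ks) \<and>
       distinct (labels (fs ! 0)) \<and>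
       (\<forall>i < length ks. \<exists>\<xi> \<alpha> \<beta>.
          fs ! i = plug \<xi> \<alpha> \<and> fs ! Suc i = plug \<xi> \<beta> \<and>
          (case ks ! i of
             None \<Rightarrow> struct_ax \<alpha> \<beta>
           | Some k \<Rightarrow> atomic_ax bar k \<alpha> \<beta> \<and>
                 set (labels \<beta>) \<inter> (\<Union>j \<le> i. occ \<Phi> j) = {})))"

definition premiss :: "('a, 'l) deriv \<Rightarrow> ('a, unit) lform" where
  "premiss \<Phi> = erase (hd (fst \<Phi>))"

definition conclusion :: "('a, 'l) deriv \<Rightarrow> ('a, unit) lform" where
  "conclusion \<Phi> = erase (last (fst \<Phi>))"

text \<open>upv e = None means up(e) = top, lov e = None means lo(e) = bottom.\<close>
record ('v, 'e) aflow =
  af_verts :: "'v set"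
  af_edges :: "'e set"
  af_lbl :: "'v \<Rightarrow> vkind"
  af_up :: "'e \<Rightarrow> 'v option"
  af_lo :: "'e \<Rightarrow> 'v option"

definition upper_edges :: "('v, 'e) aflow \<Rightarrow> 'v \<Rightarrow> 'e set" where
  "upper_edges C v = {e \<in> af_edges C. af_lo C e = Some v}"

definition lower_edges :: "('v, 'e) aflow \<Rightarrow> 'v \<Rightarrow> 'e set" where
  "lower_edges C v = {e \<in> af_edges C. af_up C e = Some v}"

fun arity :: "vkind \<Rightarrow> nat \<times> nat" where
  "arity Iv = (0, 2)" | "arity Cutv = (2, 0)" | "arity Wv = (0, 1)"
| "arity CoWv = (1, 0)" | "arity Cv = (2, 1)" | "arity CoCv = (1, 2)"

definition atomic_flow :: "('v, 'e) aflow \<Rightarrow> bool" where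
  "atomic_flow C \<longleftrightarrow>
     finite (af_verts C) \<and> finite (af_edges C) \<and>
     (\<forall>e \<in> af_edges C. (\<forall>v. af_up C e = Some v \<longrightarrow> v \<in> af_verts C) \<and>
                        (\<forall>v. af_lo C e = Some v \<longrightarrow> v \<in> af_verts C)) \<and>
     (\<forall>v \<in> af_verts C. card (upper_edges C v) = fst (arity (af_lbl C v)) \<and>
                       card (lower_edges C v) = snd (arity (af_lbl C v))) \<and>
     acyclic {(v, w). \<exists>e \<in> af_edges C. af_up C e = Some v \<and> af_lo C e = Some w} \<and>
     (\<exists>\<pi> :: 'e \<Rightarrow> bool. \<forall>v \<in> af_verts C.
        (af_lbl C v \<in> {Cv, CoCv} \<longrightarrow>
           (\<forall>e \<in> upper_edges C v \<union> lower_edges C v.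
              \<forall>e' \<in> upper_edges C v \<union> lower_edges C v. \<pi> e = \<pi> e')) \<and>
        (af_lbl C v \<in> {Iv, Cutv} \<longrightarrow>
           (\<forall>e \<in> upper_edges C v \<union> lower_edges C v.
              \<forall>e' \<in> upper_edges C v \<union> lower_edges C v. e \<noteq> e' \<longrightarrow> \<pi> e \<noteq> \<pi> e')))"

definition flow_iso :: "('v, 'e) aflow \<Rightarrow> ('w, 'f) aflow \<Rightarrow> bool" where
  "flow_iso F G \<longleftrightarrow> (\<exists>fv fe.
     bij_betw fv (af_verts F) (af_verts G) \<and> bij_betw fe (af_edges F) (af_edges G) \<and>
     (\<forall>v \<in> af_verts F. af_lbl G (fv v) = af_lbl F v) \<and>
     (\<forall>e \<in> af_edges F. af_up G (fe e) = map_option fv (af_up F e) \<and>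
                       af_lo G (fe e) = map_option fv (af_lo F e)))"

text \<open>The atomic flow of a derivation: vertices are the atomic steps, edges
  the occurrence labels; up(e) is the step creating e (top if e occurs in the
  premiss), lo(e) the step consuming e (bottom if e occurs in the conclusion).\<close>
definition flow_of :: "('a, 'l) deriv \<Rightarrow> (nat, 'l) aflow" where
  "flow_of \<Phi> = (let n = length (snd \<Phi>) in
     \<lparr> af_verts = {i. i < n \<and> snd \<Phi> ! i \<noteq> None},
       af_edges = (\<Union>i \<le> n. occ \<Phi> i),
       af_lbl = (\<lambda>i. the (snd \<Phi> ! i)),
       af_up = (\<lambda>e. if e \<in> occ \<Phi> 0 then None
                    else Some (THE i. i < n \<and> e \<notin> occ \<Phi> i \<and> e \<in> occ \<Phi> (Suc i))),
       af_lo = (\<lambda>e. if e \<in> occ \<Phi> n then None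
                    else Some (THE i. i < n \<and> e \<in> occ \<Phi> i \<and> e \<notin> occ \<Phi> (Suc i))) \<rparr>)"

text \<open>Replacement: delete the vertices DV and edges DE of C, add nv new
  vertices Inr 0 .. Inr (nv-1) labelled nl, and ne new edges Inr 0 .. Inr (ne-1)
  with endpoints nup/nlo; a retained edge whose upper (lower) vertex was deleted
  gets the new upper (lower) endpoint rup e (rlo e).  All other vertices and
  edges are unchanged.\<close>
definition replace ::
  "('v, 'e) aflow \<Rightarrow> 'v set \<Rightarrow> 'e set \<Rightarrow> (nat \<Rightarrow> vkind) \<Rightarrow> nat \<Rightarrow> nat \<Rightarrow>
   (nat \<Rightarrow> ('v + nat) option) \<Rightarrow> (nat \<Rightarrow> ('v + nat) option) \<Rightarrow>
   ('e \<Rightarrow> ('v + nat) option) \<Rightarrow> ('e \<Rightarrow> ('v + nat) option) \<Rightarrow> ('v + nat, 'e + nat) aflow"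
  where
  "replace C DV DE nl nv ne nup nlo rup rlo =
     \<lparr> af_verts = Inl ` (af_verts C - DV) \<union> Inr ` {..<nv},
       af_edges = Inl ` (af_edges C - DE) \<union> Inr ` {..<ne},
       af_lbl = case_sum (af_lbl C) nl,
       af_up = case_sum (\<lambda>e. case af_up C e of None \<Rightarrow> None
                               | Some v \<Rightarrow> if v \<in> DV then rup e else Some (Inl v)) nup,
       af_lo = case_sum (\<lambda>e. case af_lo C e of None \<Rightarrow> None
                               | Some v \<Rightarrow> if v \<in> DV then rlo e else Some (Inl v)) nlo \<rparr>"

datatype rrule = WdCd | WdIu | WdWu | WdCu | CdIu | CdCu | CuWu | IdWu | CdWu | IdCu

definition noedge :: "nat \<Rightarrow> ('v + nat) option" where "noedge = (\<lambda>_. None)"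

fun reduces :: "rrule \<Rightarrow> ('v, 'e) aflow \<Rightarrow> ('v, 'e) aflow \<Rightarrow> bool" where
  "reduces WdCd C D \<longleftrightarrow> atomic_flow C \<and>
     (\<exists>w c \<epsilon> \<epsilon>1 \<epsilon>2. w \<in> af_verts C \<and> af_lbl C w = Wv \<and> c \<in> af_verts C \<and> af_lbl C c = Cv \<and>
        \<epsilon> \<in> af_edges C \<and> af_up C \<epsilon> = Some w \<and> af_lo C \<epsilon> = Some c \<and>
        \<epsilon>1 \<in> af_edges C \<and> \<epsilon>1 \<noteq> \<epsilon> \<and> af_lo C \<epsilon>1 = Some c \<and>
        \<epsilon>2 \<in> af_edges C \<and> af_up C \<epsilon>2 = Some c \<and>
        flow_iso (replace C {w, c} {\<epsilon>, \<epsilon>2} (\<lambda>_. Wv) 0 0 noedge noedge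
                    (\<lambda>_. None) (\<lambda>_. map_option Inl (af_lo C \<epsilon>2))) D)"
| "reduces CuWu C D \<longleftrightarrow> atomic_flow C \<and>
     (\<exists>k cc \<epsilon> \<epsilon>1 \<epsilon>2. k \<in> af_verts C \<and> af_lbl C k = CoWv \<and> cc \<in> af_verts C \<and> af_lbl C cc = CoCv \<and>
        \<epsilon> \<in> af_edges C \<and> af_up C \<epsilon> = Some cc \<and> af_lo C \<epsilon> = Some k \<and>
        \<epsilon>1 \<in> af_edges C \<and> \<epsilon>1 \<noteq> \<epsilon> \<and> af_up C \<epsilon>1 = Some cc \<and>
        \<epsilon>2 \<in> af_edges C \<and> af_lo C \<epsilon>2 = Some cc \<and>
        flow_iso (replace C {k, cc} {\<epsilon>, \<epsilon>2} (\<lambda>_. Wv) 0 0 noedge noedge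
                    (\<lambda>_. map_option Inl (af_up C \<epsilon>2)) (\<lambda>_. None)) D)"
| "reduces WdIu C D \<longleftrightarrow> atomic_flow C \<and>
     (\<exists>w u \<epsilon> \<epsilon>1. w \<in> af_verts C \<and> af_lbl C w = Wv \<and> u \<in> af_verts C \<and> af_lbl C u = Cutv \<and>
        \<epsilon> \<in> af_edges C \<and> af_up C \<epsilon> = Some w \<and> af_lo C \<epsilon> = Some u \<and>
        \<epsilon>1 \<in> af_edges C \<and> \<epsilon>1 \<noteq> \<epsilon> \<and> af_lo C \<epsilon>1 = Some u \<and>
        flow_iso (replace C {w, u} {\<epsilon>} (\<lambda>_. CoWv) 1 0 noedge noedge
                    (\<lambda>_. None) (\<lambda>_. Some (Inr 0))) D)"
| "reduces IdWu C D \<longleftrightarrow> atomic_flow C \<and>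
     (\<exists>i k \<epsilon> \<epsilon>1. i \<in> af_verts C \<and> af_lbl C i = Iv \<and> k \<in> af_verts C \<and> af_lbl C k = CoWv \<and>
        \<epsilon> \<in> af_edges C \<and> af_up C \<epsilon> = Some i \<and> af_lo C \<epsilon> = Some k \<and>
        \<epsilon>1 \<in> af_edges C \<and> \<epsilon>1 \<noteq> \<epsilon> \<and> af_up C \<epsilon>1 = Some i \<and>
        flow_iso (replace C {i, k} {\<epsilon>} (\<lambda>_. Wv) 1 0 noedge noedge
                    (\<lambda>_. Some (Inr 0)) (\<lambda>_. None)) D)"
| "reduces WdWu C D \<longleftrightarrow> atomic_flow C \<and>
     (\<exists>w k \<epsilon>. w \<in> af_verts C \<and> af_lbl C w = Wv \<and> k \<in> af_verts C \<and> af_lbl C k = CoWv \<and>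
        \<epsilon> \<in> af_edges C \<and> af_up C \<epsilon> = Some w \<and> af_lo C \<epsilon> = Some k \<and>
        flow_iso (replace C {w, k} {\<epsilon>} (\<lambda>_. Wv) 0 0 noedge noedge
                    (\<lambda>_. None) (\<lambda>_. None)) D)"
| "reduces WdCu C D \<longleftrightarrow> atomic_flow C \<and>
     (\<exists>w cc \<epsilon> \<epsilon>1 \<epsilon>2. w \<in> af_verts C \<and> af_lbl C w = Wv \<and> cc \<in> af_verts C \<and> af_lbl C cc = CoCv \<and>
        \<epsilon> \<in> af_edges C \<and> af_up C \<epsilon> = Some w \<and> af_lo C \<epsilon> = Some cc \<and>
        \<epsilon>1 \<in> af_edges C \<and> af_up C \<epsilon>1 = Some cc \<and>
        \<epsilon>2 \<in> af_edges C \<and> af_up C \<epsilon>2 = Some cc \<and> \<epsilon>1 \<noteq> \<epsilon>2 \<and>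
        flow_iso (replace C {w, cc} {\<epsilon>} (\<lambda>_. Wv) 2 0 noedge noedge
                    (\<lambda>e. if e = \<epsilon>1 then Some (Inr 0) else Some (Inr 1)) (\<lambda>_. None)) D)"
| "reduces CdWu C D \<longleftrightarrow> atomic_flow C \<and>
     (\<exists>k c \<epsilon> \<epsilon>1 \<epsilon>2. k \<in> af_verts C \<and> af_lbl C k = CoWv \<and> c \<in> af_verts C \<and> af_lbl C c = Cv \<and>
        \<epsilon> \<in> af_edges C \<and> af_up C \<epsilon> = Some c \<and> af_lo C \<epsilon> = Some k \<and>
        \<epsilon>1 \<in> af_edges C \<and> af_lo C \<epsilon>1 = Some c \<and>
        \<epsilon>2 \<in> af_edges C \<and> af_lo C \<epsilon>2 = Some c \<and> \<epsilon>1 \<noteq> \<epsilon>2 \<and>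
        flow_iso (replace C {k, c} {\<epsilon>} (\<lambda>_. CoWv) 2 0 noedge noedge
                    (\<lambda>_. None) (\<lambda>e. if e = \<epsilon>1 then Some (Inr 0) else Some (Inr 1))) D)"
| "reduces CdIu C D \<longleftrightarrow> atomic_flow C \<and>
     (\<exists>c u \<epsilon> \<epsilon>1 \<epsilon>2 \<epsilon>3. c \<in> af_verts C \<and> af_lbl C c = Cv \<and> u \<in> af_verts C \<and> af_lbl C u = Cutv \<and>
        \<epsilon>1 \<in> af_edges C \<and> af_lo C \<epsilon>1 = Some c \<and>
        \<epsilon>2 \<in> af_edges C \<and> af_lo C \<epsilon>2 = Some c \<and> \<epsilon>1 \<noteq> \<epsilon>2 \<and>
        \<epsilon> \<in> af_edges C \<and> af_up C \<epsilon> = Some c \<and> af_lo C \<epsilon> = Some u \<and>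
        \<epsilon>3 \<in> af_edges C \<and> \<epsilon>3 \<noteq> \<epsilon> \<and> af_lo C \<epsilon>3 = Some u \<and>
        flow_iso (replace C {c, u} {\<epsilon>}
                    (\<lambda>j. if j = 0 then CoCv else Cutv) 3 2
                    (\<lambda>_. Some (Inr 0)) (\<lambda>j. Some (Inr (Suc j)))
                    (\<lambda>_. None)
                    (\<lambda>e. if e = \<epsilon>3 then Some (Inr 0) else if e = \<epsilon>1 then Some (Inr 1)
                         else Some (Inr 2))) D)"
| "reduces IdCu C D \<longleftrightarrow> atomic_flow C \<and>
     (\<exists>i cc \<epsilon>1 \<epsilon>2 \<epsilon>3 \<epsilon>4. i \<in> af_verts C \<and> af_lbl C i = Iv \<and> cc \<in> af_verts C \<and> af_lbl C cc = CoCv \<and>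
        \<epsilon>3 \<in> af_edges C \<and> af_up C \<epsilon>3 = Some i \<and>
        \<epsilon>4 \<in> af_edges C \<and> af_up C \<epsilon>4 = Some i \<and> \<epsilon>3 \<noteq> \<epsilon>4 \<and> af_lo C \<epsilon>4 = Some cc \<and>
        \<epsilon>1 \<in> af_edges C \<and> af_up C \<epsilon>1 = Some cc \<and>
        \<epsilon>2 \<in> af_edges C \<and> af_up C \<epsilon>2 = Some cc \<and> \<epsilon>1 \<noteq> \<epsilon>2 \<and>
        flow_iso (replace C {i, cc} {\<epsilon>4}
                    (\<lambda>j. if j = 0 then Cv else Iv) 3 2
                    (\<lambda>j. Some (Inr (Suc j))) (\<lambda>_. Some (Inr 0))
                    (\<lambda>e. if e = \<epsilon>3 then Some (Inr 0) else if e = \<epsilon>1 then Some (Inr 1)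
                         else Some (Inr 2))
                    (\<lambda>_. None)) D)"
| "reduces CdCu C D \<longleftrightarrow> atomic_flow C \<and>
     (\<exists>c cc \<epsilon> \<epsilon>1 \<epsilon>2 \<epsilon>3 \<epsilon>4. c \<in> af_verts C \<and> af_lbl C c = Cv \<and> cc \<in> af_verts C \<and> af_lbl C cc = CoCv \<and>
        \<epsilon>1 \<in> af_edges C \<and> af_lo C \<epsilon>1 = Some c \<and>
        \<epsilon>2 \<in> af_edges C \<and> af_lo C \<epsilon>2 = Some c \<and> \<epsilon>1 \<noteq> \<epsilon>2 \<and>
        \<epsilon> \<in> af_edges C \<and> af_up C \<epsilon> = Some c \<and> af_lo C \<epsilon> = Some cc \<and>
        \<epsilon>3 \<in> af_edges C \<and> af_up C \<epsilon>3 = Some cc \<and>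
        \<epsilon>4 \<in> af_edges C \<and> af_up C \<epsilon>4 = Some cc \<and> \<epsilon>3 \<noteq> \<epsilon>4 \<and>
        flow_iso (replace C {c, cc} {\<epsilon>}
                    (\<lambda>j. if j < 2 then CoCv else Cv) 4 4
                    (\<lambda>j. Some (Inr (j div 2))) (\<lambda>j. Some (Inr (2 + j mod 2)))
                    (\<lambda>e. if e = \<epsilon>3 then Some (Inr 2) else Some (Inr 3))
                    (\<lambda>e. if e = \<epsilon>1 then Some (Inr 0) else Some (Inr 1))) D)"

end

theory Submission
  imports Defs
begin

text \<open>
  A derivation with flow \<open>C\<close> is a derivation whose atomic steps are indexed by the vertices of \<open>C\<close>,
  each consuming and producing exactly the edges of \<open>C\<close> at its vertex. Replacing every occurrence
  of one edge by a fixed formula commutes with all steps except those at the two end points of the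
  edge. For each reduction the edge between the two vertices is replaced throughout the derivation:
  by \<open>f\<close> if it comes from a weakening (in \<open>w\<down>-w\<up>\<close> the resulting step from \<open>f\<close> to \<open>t\<close> is a switch
  up to units), otherwise by \<open>t\<close> if it goes to a coweakening, by the disjunction of the two upper
  edges in \<open>c\<down>-i\<up>\<close> and \<open>c\<down>-c\<up>\<close>, and by the conjunction of the two lower edges in \<open>i\<down>-c\<up>\<close>. It
  remains to repair the two steps at the end points by small derivations that contain exactly the
  new vertices.
\<close>

section \<open>Substitution for labelled atom occurrences\<close>

text \<open>The obstacle is freshness. \<open>is_deriv\<close> relates the labels of each new atom
  to all earlier formulae, and \<open>flow_of\<close> recovers the end points of an edge by definite
  description, so substituting inside a labelled derivation would mean redoing this global
  bookkeeping for every rule. With the flow fixed in advance, correctness of an atomic step is a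
  local condition at its vertex; freshness then follows, once and for all, because each vertex is
  used exactly once and each edge has a single upper end. Hence the translations in both directions,
  with all repairs made in between. A flow forgets which atom an edge carries. The replacement of an
  occurrence is therefore a function of its atom as well as of its label, and the label type may
  change because \<open>replace\<close> names edges in a sum type. The replaced edge lies between
  the two vertices of the pattern, so it occurs neither in the premiss nor in the conclusion, and
  both survive up to the names of labels. Two rules also merge two edges; this becomes a renaming of
  labels that is not injective.\<close>

fun lsubst :: "('a \<Rightarrow> 'l \<Rightarrow> ('a, 'm) lform) \<Rightarrow> ('a, 'l) lform \<Rightarrow> ('a, 'm) lform" where
  "lsubst f Ff = Ff"
| "lsubst f Tt = Tt"
| "lsubst f (At a e) = f a e"
| "lsubst f (Or x y) = Or (lsubst f x) (lsubst f y)"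
| "lsubst f (And x y) = And (lsubst f x) (lsubst f y)"

fun csubst :: "('a \<Rightarrow> 'l \<Rightarrow> ('a, 'm) lform) \<Rightarrow> ('a, 'l) ctx \<Rightarrow> ('a, 'm) ctx" where
  "csubst f Hole = Hole"
| "csubst f (OrL c y) = OrL (csubst f c) (lsubst f y)"
| "csubst f (OrR y c) = OrR (lsubst f y) (csubst f c)"
| "csubst f (AndL c y) = AndL (csubst f c) (lsubst f y)"
| "csubst f (AndR y c) = AndR (lsubst f y) (csubst f c)"

fun ctx_comp :: "('a, 'l) ctx \<Rightarrow> ('a, 'l) ctx \<Rightarrow> ('a, 'l) ctx" where
  "ctx_comp Hole d = d"
| "ctx_comp (OrL c y) d = OrL (ctx_comp c d) y"
| "ctx_comp (OrR y c) d = OrR y (ctx_comp c d)"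
| "ctx_comp (AndL c y) d = AndL (ctx_comp c d) y"
| "ctx_comp (AndR y c) d = AndR y (ctx_comp c d)"

fun ctx_labels :: "('a, 'l) ctx \<Rightarrow> 'l list" where
  "ctx_labels Hole = []"
| "ctx_labels (OrL c y) = ctx_labels c @ labels y"
| "ctx_labels (OrR y c) = labels y @ ctx_labels c"
| "ctx_labels (AndL c y) = ctx_labels c @ labels y"
| "ctx_labels (AndR y c) = labels y @ ctx_labels c"

lemma plug_ctx_comp: "plug (ctx_comp c d) x = plug c (plug d x)"
  by (induction c) auto

lemma lsubst_plug: "lsubst f (plug c x) = plug (csubst f c) (lsubst f x)"
  by (induction c) auto

lemma set_labels_plug: "set (labels (plug c x)) = set (ctx_labels c) \<union> set (labels x)"
  by (induction c) auto

lemma distinct_labels_plug: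
  "distinct (labels (plug c x)) \<longleftrightarrow>
     distinct (ctx_labels c) \<and> distinct (labels x) \<and> set (ctx_labels c) \<inter> set (labels x) = {}"
  by (induction c) (auto simp: set_labels_plug)

lemma eq_ax_lsubst: "eq_ax x y \<Longrightarrow> eq_ax (lsubst f x) (lsubst f y)"
  by (induction rule: eq_ax.induct) (auto intro: eq_ax.intros)

text \<open>These rules are schematic in their subformulae and mention no atoms, only units, which
  substitution fixes.\<close>

lemma struct_ax_lsubst: "struct_ax x y \<Longrightarrow> struct_ax (lsubst f x) (lsubst f y)"
  by (induction rule: struct_ax.induct) (auto intro: struct_ax.intros eq_ax_lsubst)

lemma eq_ax_labels:
  "eq_ax x y \<Longrightarrow> set (labels x) = set (labels y) \<and> (distinct (labels x) \<longleftrightarrow> distinct (labels y))"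
  by (induction rule: eq_ax.induct) auto

lemma struct_ax_labels:
  "struct_ax x y \<Longrightarrow> set (labels x) = set (labels y) \<and> (distinct (labels x) \<longleftrightarrow> distinct (labels y))"
  by (induction rule: struct_ax.induct) (auto dest: eq_ax_labels)

lemma atomic_ax_distinct: "atomic_ax bar k x y \<Longrightarrow> distinct (labels y)"
  by (induction rule: atomic_ax.induct) auto

lemma lsubst_ordinary:
  assumes "\<forall>e \<in> set (labels x). \<forall>b. f b e = At b (g e)"
  shows "labels (lsubst f x) = map g (labels x)" and "erase (lsubst f x) = erase x"
  using assms by (induction x) (auto simp: erase_def)

text \<open>Interaction and cocontraction have distinct conclusion labels as a side condition, so
  the renaming must be injective there; on the premiss it may identify labels.\<close>

lemma atomic_ax_lsubst:
  assumes "atomic_ax bar k x y"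
    and "\<forall>e \<in> set (labels x) \<union> set (labels y). \<forall>b. f b e = At b (g e)"
    and "inj_on g (set (labels y))"
  shows "atomic_ax bar k (lsubst f x) (lsubst f y)"
  using assms by (induction rule: atomic_ax.induct) (auto intro!: atomic_ax.intros)

section \<open>Derivations over a flow\<close>

text \<open>The end point is an option, so that \<open>None\<close> stands for the boundary (premiss
  for \<open>edges_from\<close>, conclusion for \<open>edges_to\<close>) and one statement covers
  both vertices and boundary.\<close>

definition edges_from :: "('v, 'e) aflow \<Rightarrow> 'v option \<Rightarrow> 'e set" where
  "edges_from C x = {e \<in> af_edges C. af_up C e = x}"

definition edges_to :: "('v, 'e) aflow \<Rightarrow> 'v option \<Rightarrow> 'e set" where
  "edges_to C x = {e \<in> af_edges C. af_lo C e = x}"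

text \<open>This guarantees that every edge with an upper end is created by a vertex that a
  derivation actually uses, hence occurs in it.\<close>

definition flow_wf :: "('v, 'e) aflow \<Rightarrow> bool" where
  "flow_wf C \<longleftrightarrow> (\<forall>e \<in> af_edges C. af_up C e \<in> insert None (Some ` af_verts C) \<and>
                                     af_lo C e \<in> insert None (Some ` af_verts C))"

text \<open>Edges are compared as sets because a flow does not order the edges at a vertex; the
  left-right order inside the redex remains open.\<close>

definition step_at :: "('a \<Rightarrow> 'a) \<Rightarrow> ('v, 'l) aflow \<Rightarrow> 'v \<Rightarrow> ('a, 'l) lform \<Rightarrow> ('a, 'l) lform \<Rightarrow> bool"
  where
  "step_at bar C v x y \<longleftrightarrow> atomic_ax bar (af_lbl C v) x y \<and>
     set (labels x) = edges_to C (Some v) \<and> set (labels y) = edges_from C (Some v)"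

inductive der :: "('a \<Rightarrow> 'a) \<Rightarrow> ('v, 'l) aflow \<Rightarrow> ('a, 'l) lform \<Rightarrow> 'v list \<Rightarrow> ('a, 'l) lform \<Rightarrow> bool"
  for bar C where
  der_refl: "der bar C x [] x"
| der_struct_step: "struct_ax \<alpha> \<beta> \<Longrightarrow> der bar C (plug \<xi> \<beta>) vs x \<Longrightarrow> der bar C (plug \<xi> \<alpha>) vs x"
| der_atomic_step: "step_at bar C v \<alpha> \<beta> \<Longrightarrow> der bar C (plug \<xi> \<beta>) vs x \<Longrightarrow>
    der bar C (plug \<xi> \<alpha>) (v # vs) x"

lemma der_trans: "der bar C x vs y \<Longrightarrow> der bar C y ws z \<Longrightarrow> der bar C x (vs @ ws) z"
  by (induction rule: der.induct) (auto intro: der.intros)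

lemma der_plug: "der bar C x vs y \<Longrightarrow> der bar C (plug c x) vs (plug c y)"
proof (induction rule: der.induct)
  case (der_struct_step \<alpha> \<beta> \<xi> vs x)
  then show ?case
    using der.der_struct_step[of \<alpha> \<beta> bar C "ctx_comp c \<xi>"] by (simp add: plug_ctx_comp)
next
  case (der_atomic_step v \<alpha> \<beta> \<xi> vs x)
  then show ?case
    using der.der_atomic_step[of bar C v \<alpha> \<beta> "ctx_comp c \<xi>"] by (simp add: plug_ctx_comp)
qed (rule der_refl)

lemma der_struct: "struct_ax x y \<Longrightarrow> der bar C x [] y"
  using der_struct_step[of x y bar C Hole "[]" y] by (simp add: der_refl)

lemma der_eq: "eq_ax x y \<Longrightarrow> der bar C x [] y" "eq_ax x y \<Longrightarrow> der bar C y [] x"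
  by (auto intro: der_struct struct_ax.intros)

lemma der_atomic: "step_at bar C v x y \<Longrightarrow> der bar C x [v] y"
  using der_atomic_step[of bar C v x y Hole "[]" y] by (simp add: der_refl)

text \<open>Since \<open>der\<close> is closed under contexts and composition, it is enough to treat
  each vertex on its own: the step at \<open>v\<close> is replaced by a derivation using the
  vertices \<open>T v\<close>.\<close>

lemma der_lsubst:
  assumes "der bar C x vs y"
    and "\<And>v \<alpha> \<beta>. v \<in> set vs \<Longrightarrow> step_at bar C v \<alpha> \<beta> \<Longrightarrow>
           der bar D (lsubst f \<alpha>) (T v) (lsubst f \<beta>)"
  shows "der bar D (lsubst f x) (concat (map T vs)) (lsubst f y)"
  using assms
proof (induction rule: der.induct)
  case (der_refl x)
  then show ?case by (simp add: der.der_refl)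
next
  case (der_struct_step \<alpha> \<beta> \<xi> vs x)
  then show ?case
    by (auto simp: lsubst_plug intro: der.der_struct_step struct_ax_lsubst)
next
  case (der_atomic_step v \<alpha> \<beta> \<xi> vs x)
  have "der bar D (lsubst f (plug \<xi> \<alpha>)) (T v) (lsubst f (plug \<xi> \<beta>))"
    unfolding lsubst_plug
    by (rule der_plug, rule der_atomic_step.prems[of v]) (use der_atomic_step.hyps in auto)
  moreover have "der bar D (lsubst f (plug \<xi> \<beta>)) (concat (map T vs)) (lsubst f x)"
    by (rule der_atomic_step.IH) (use der_atomic_step.prems in auto)
  ultimately show ?case by (simp add: der_trans)
qed

section \<open>Flows realized by a derivation, and their transfer under substitution\<close>

definition realizes ::
  "('a \<Rightarrow> 'a) \<Rightarrow> ('v, 'l) aflow \<Rightarrow> ('a, 'l) lform \<Rightarrow> 'v list \<Rightarrow> ('a, 'l) lform \<Rightarrow> bool" where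
  "realizes bar C x vs y \<longleftrightarrow> der bar C x vs y \<and> distinct vs \<and> set vs = af_verts C \<and>
     distinct (labels x) \<and> set (labels x) = edges_from C None \<and>
     set (labels y) = edges_to C None \<and> flow_wf C"

definition realizable ::
  "('a \<Rightarrow> 'a) \<Rightarrow> ('v, 'l) aflow \<Rightarrow> ('a, unit) lform \<Rightarrow> ('a, unit) lform \<Rightarrow> bool" where
  "realizable bar C P Q \<longleftrightarrow> (\<exists>x vs y. realizes bar C x vs y \<and> erase x = P \<and> erase y = Q)"

lemma distinct_concat_map:
  assumes "distinct vs" and "\<And>v. v \<in> set vs \<Longrightarrow> distinct (T v)"
    and "\<And>v w. v \<in> set vs \<Longrightarrow> w \<in> set vs \<Longrightarrow> v \<noteq> w \<Longrightarrow> set (T v) \<inter> set (T w) = {}"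
  shows "distinct (concat (map T vs))"
  using assms
proof (induction vs)
  case (Cons a vs)
  have "set (T a) \<inter> set (T v) = {}" if "v \<in> set vs" for v
    using Cons.prems(1) Cons.prems(3)[of a v] that by auto
  moreover have "distinct (concat (map T vs))"
    using Cons.prems by (intro Cons.IH) auto
  ultimately show ?case using Cons.prems(2)[of a] by auto
qed simp

text \<open>The common frame of all reductions. \<open>S\<close> holds the vertices of the pattern;
  every other vertex is only renamed by \<open>h\<close> and its edges by \<open>g\<close>. The case
  \<open>x = None\<close> of the boundary condition keeps the premiss and the conclusion, and
  injectivity is demanded only among edges created together, which leaves room for merging. The
  lists \<open>T v\<close> must split the vertices of \<open>D\<close>, so that each is used
  once.\<close>

lemma realizable_lsubst:
  assumes real: "realizable bar C P Q" and wf: "flow_wf D"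
    and bnd: "\<And>x. x \<in> insert None (Some ` (af_verts C - S)) \<Longrightarrow>
        edges_from D (map_option h x) = g ` edges_from C x \<and>
        edges_to D (map_option h x) = g ` edges_to C x \<and>
        inj_on g (edges_from C x) \<and>
        (\<forall>e \<in> edges_from C x \<union> edges_to C x. \<forall>b. f b e = At b (g e))"
    and lbl: "\<And>v. v \<in> af_verts C - S \<Longrightarrow> af_lbl D (h v) = af_lbl C v"
    and ordinary: "\<And>v. v \<in> af_verts C - S \<Longrightarrow> T v = [h v]"
    and special: "\<And>v \<alpha> \<beta>. v \<in> af_verts C \<inter> S \<Longrightarrow> step_at bar C v \<alpha> \<beta> \<Longrightarrow>
        der bar D (lsubst f \<alpha>) (T v) (lsubst f \<beta>)"
    and dist: "\<And>v. v \<in> af_verts C \<Longrightarrow> distinct (T v)"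
    and disj: "\<And>v w. v \<in> af_verts C \<Longrightarrow> w \<in> af_verts C \<Longrightarrow> v \<noteq> w \<Longrightarrow> set (T v) \<inter> set (T w) = {}"
    and verts: "(\<Union>v \<in> af_verts C. set (T v)) = af_verts D"
  shows "realizable bar D P Q"
proof -
  obtain x vs y where r: "realizes bar C x vs y" "erase x = P" "erase y = Q"
    using real by (auto simp: realizable_def)
  have vs: "set vs = af_verts C" "distinct vs" using r(1) by (auto simp: realizes_def)
  have d: "der bar D (lsubst f x) (concat (map T vs)) (lsubst f y)"
  proof (rule der_lsubst)
    show "der bar C x vs y" using r(1) by (simp add: realizes_def)
    fix v \<alpha> \<beta> assume v: "v \<in> set vs" and st: "step_at bar C v \<alpha> \<beta>"
    show "der bar D (lsubst f \<alpha>) (T v) (lsubst f \<beta>)"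
    proof (cases "v \<in> S")
      case True
      then show ?thesis using special st v vs by auto
    next
      case False
      then have v': "v \<in> af_verts C - S" using v vs by auto
      have b: "edges_from D (Some (h v)) = g ` edges_from C (Some v)"
        "edges_to D (Some (h v)) = g ` edges_to C (Some v)"
        "inj_on g (edges_from C (Some v))"
        "\<forall>e \<in> edges_from C (Some v) \<union> edges_to C (Some v). \<forall>b. f b e = At b (g e)"
        using bnd[of "Some v"] v' by auto
      have "step_at bar D (h v) (lsubst f \<alpha>) (lsubst f \<beta>)"
        unfolding step_at_def
      proof (intro conjI)
        show "atomic_ax bar (af_lbl D (h v)) (lsubst f \<alpha>) (lsubst f \<beta>)"
          using st b lbl[OF v'] by (auto simp: step_at_def intro!: atomic_ax_lsubst[where g = g])
        show "set (labels (lsubst f \<alpha>)) = edges_to D (Some (h v))"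
          using st b by (subst lsubst_ordinary(1)[where g = g]) (auto simp: step_at_def)
        show "set (labels (lsubst f \<beta>)) = edges_from D (Some (h v))"
          using st b by (subst lsubst_ordinary(1)[where g = g]) (auto simp: step_at_def)
      qed
      then show ?thesis using ordinary[OF v'] by (simp add: der_atomic)
    qed
  qed
  have N: "edges_from D None = g ` edges_from C None" "edges_to D None = g ` edges_to C None"
    "inj_on g (edges_from C None)"
    "\<forall>e \<in> edges_from C None \<union> edges_to C None. \<forall>b. f b e = At b (g e)"
    using bnd[of None] by auto
  have lx: "set (labels x) = edges_from C None" "distinct (labels x)"
    and ly: "set (labels y) = edges_to C None"
    using r(1) by (auto simp: realizes_def)
  have ox: "\<forall>e \<in> set (labels x). \<forall>b. f b e = At b (g e)"
    and oy: "\<forall>e \<in> set (labels y). \<forall>b. f b e = At b (g e)"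
    using N lx ly by auto
  have "distinct (concat (map T vs))"
    by (rule distinct_concat_map) (use vs dist disj in auto)
  then have "realizes bar D (lsubst f x) (concat (map T vs)) (lsubst f y)"
    unfolding realizes_def
    using d vs verts wf N lx ly lsubst_ordinary(1)[OF ox] lsubst_ordinary(1)[OF oy]
    by (auto simp: distinct_map)
  moreover have "erase (lsubst f x) = P" "erase (lsubst f y) = Q"
    using r lsubst_ordinary(2)[OF ox] lsubst_ordinary(2)[OF oy] by auto
  ultimately show ?thesis unfolding realizable_def by blast
qed

lemma realizable_flow_wf: "realizable bar C P Q \<Longrightarrow> flow_wf C"
  by (auto simp: realizable_def realizes_def)

text \<open>A pure renaming: \<open>realizable_lsubst\<close> with no special vertex.\<close>

lemma realizable_iso:
  assumes real: "realizable bar C P Q" and "flow_iso C D"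
  shows "realizable bar D P Q"
proof -
  obtain h g where h: "bij_betw h (af_verts C) (af_verts D)"
    and g: "bij_betw g (af_edges C) (af_edges D)"
    and lbl: "\<forall>v \<in> af_verts C. af_lbl D (h v) = af_lbl C v"
    and e: "\<forall>e \<in> af_edges C. af_up D (g e) = map_option h (af_up C e) \<and>
                       af_lo D (g e) = map_option h (af_lo C e)"
    using assms(2) unfolding flow_iso_def by blast
  have wf: "flow_wf C" using real by (rule realizable_flow_wf)
  have wfD: "flow_wf D"
    unfolding flow_wf_def
  proof
    fix e' assume "e' \<in> af_edges D"
    then obtain e0 where "e0 \<in> af_edges C" "e' = g e0"
      using g by (auto simp: bij_betw_def)
    with wf e h show "af_up D e' \<in> insert None (Some ` af_verts D) \<and>
        af_lo D e' \<in> insert None (Some ` af_verts D)"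
      by (fastforce simp: flow_wf_def bij_betw_def)
  qed
  \<comment> \<open>End points in \<open>D\<close> can be pulled back only where \<open>h\<close> is
    injective; \<open>flow_wf\<close> keeps all end points in that range.\<close>
  have inj: "inj_on (map_option h) (insert None (Some ` af_verts C))"
    using h by (auto simp: inj_on_def bij_betw_def)
  have ends: "(af_up D (g e') = map_option h x) = (af_up C e' = x)"
    "(af_lo D (g e') = map_option h x) = (af_lo C e' = x)"
    if "e' \<in> af_edges C" "x \<in> insert None (Some ` af_verts C)" for e' x
    using that e wf inj_onD[OF inj, of _ x] unfolding flow_wf_def by (metis)+
  have img: "edges_from D (map_option h x) = g ` edges_from C x"
    "edges_to D (map_option h x) = g ` edges_to C x"
    if "x \<in> insert None (Some ` af_verts C)" for x
  proof -
    have "af_edges D = g ` af_edges C" using g by (auto simp: bij_betw_def)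
    then show "edges_from D (map_option h x) = g ` edges_from C x"
      "edges_to D (map_option h x) = g ` edges_to C x"
      using ends[OF _ that] by (auto simp: edges_from_def edges_to_def)
  qed
  show ?thesis
  proof (rule realizable_lsubst[OF real wfD, where S = "{}" and h = h and g = g
        and f = "\<lambda>b e. At b (g e)" and T = "\<lambda>v. [h v]"])
    fix x assume "x \<in> insert None (Some ` (af_verts C - {}))"
    then show "edges_from D (map_option h x) = g ` edges_from C x \<and>
        edges_to D (map_option h x) = g ` edges_to C x \<and>
        inj_on g (edges_from C x) \<and>
        (\<forall>e \<in> edges_from C x \<union> edges_to C x. \<forall>b. At b (g e) = At b (g e))"
      using img g by (auto simp: bij_betw_def edges_from_def inj_on_def)
  qed (use lbl h in \<open>auto simp: bij_betw_def inj_on_def\<close>)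
qed

section \<open>Labelled derivations and derivations over a flow\<close>

lemma nat_first_change:
  fixes P :: "nat \<Rightarrow> bool"
  assumes "\<not> P i" and "P k" and "i \<le> k"
  obtains j where "i \<le> j" "j < k" "\<not> P j" "P (Suc j)"
proof -
  have "\<exists>j. i \<le> j \<and> j < k \<and> \<not> P j \<and> P (Suc j)"
    using assms(3,2,1)
  proof (induction rule: dec_induct)
    case (step m)
    then show ?case by (cases "P m") (auto intro: less_SucI)
  qed simp
  with that show ?thesis by blast
qed

text \<open>By freshness, the formulae containing a given label form an interval of indices; its two
  ends are the unique witnesses of the definite descriptions in \<open>flow_of\<close>.\<close>

lemma realizable_flow_of:
  assumes d: "is_deriv bar \<Phi>"
  shows "realizable bar (flow_of \<Phi>) (premiss \<Phi>) (conclusion \<Phi>)"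
proof -
  define fs where "fs = fst \<Phi>"
  define ks where "ks = snd \<Phi>"
  define n where "n = length ks"
  let ?C = "flow_of \<Phi>"
  note defs = fs_def[symmetric] ks_def[symmetric] n_def[symmetric]
  have len: "length fs = Suc n" and d0: "distinct (labels (fs ! 0))"
    using d by (auto simp: is_deriv_def Let_def defs)
  have steps: "\<exists>\<xi> \<alpha> \<beta>. fs ! i = plug \<xi> \<alpha> \<and> fs ! Suc i = plug \<xi> \<beta> \<and>
          (case ks ! i of
             None \<Rightarrow> struct_ax \<alpha> \<beta>
           | Some k \<Rightarrow> atomic_ax bar k \<alpha> \<beta> \<and> set (labels \<beta>) \<inter> (\<Union>j \<le> i. occ \<Phi> j) = {})"
    if "i < n" for i
    using d that by (auto simp: is_deriv_def Let_def defs)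
  have occ: "occ \<Phi> i = set (labels (fs ! i))" for i by (simp add: occ_def fs_def)
  have dist: "distinct (labels (fs ! i))" if "i \<le> n" for i
    using that
  proof (induction i)
    case (Suc i)
    from steps[of i] Suc.prems obtain \<xi> \<alpha> \<beta> where st: "fs ! i = plug \<xi> \<alpha>" "fs ! Suc i = plug \<xi> \<beta>"
      "case ks ! i of None \<Rightarrow> struct_ax \<alpha> \<beta>
        | Some k \<Rightarrow> atomic_ax bar k \<alpha> \<beta> \<and> set (labels \<beta>) \<inter> (\<Union>j \<le> i. occ \<Phi> j) = {}"
      by auto
    have IH: "distinct (labels (plug \<xi> \<alpha>))" using Suc st by simp
    show ?case
    proof (cases "ks ! i")
      case None
      then show ?thesis using st IH struct_ax_labels[of \<alpha> \<beta>] by (auto simp: distinct_labels_plug)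
    next
      case (Some k)
      then have "set (labels \<beta>) \<inter> occ \<Phi> i = {}" "atomic_ax bar k \<alpha> \<beta>" using st by auto
      then show ?thesis using st IH atomic_ax_distinct[of bar k \<alpha> \<beta>]
        by (auto simp: distinct_labels_plug occ set_labels_plug)
    qed
  qed (use d0 in simp)
  \<comment> \<open>Structural steps preserve the set of labels, so a label that appears belongs to
    the conclusion of an atomic redex, where freshness excludes it from all formulae so far.\<close>
  have created: "ks ! i \<noteq> None \<and> (\<forall>j \<le> i. e \<notin> occ \<Phi> j)"
    if "i < n" "e \<notin> occ \<Phi> i" "e \<in> occ \<Phi> (Suc i)" for i e
    using steps[OF that(1)] that(2,3)
    by (auto simp: occ set_labels_plug dest: struct_ax_labels split: option.splits) blast
  have consumed: "ks ! i \<noteq> None" if "i < n" "e \<in> occ \<Phi> i" "e \<notin> occ \<Phi> (Suc i)" for i e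
    using steps[OF that(1)] that(2,3)
    by (auto simp: occ set_labels_plug dest: struct_ax_labels split: option.splits)
  \<comment> \<open>A gap would end in a second creation of the label, although it already occurred
    before the gap.\<close>
  have persist: "e \<in> occ \<Phi> j" if p: "e \<in> occ \<Phi> i" "e \<in> occ \<Phi> k" "i \<le> j" "j \<le> k" "k \<le> n" for e i j k
  proof (rule ccontr)
    assume "e \<notin> occ \<Phi> j"
    then obtain l where "j \<le> l" "l < k" "e \<notin> occ \<Phi> l" "e \<in> occ \<Phi> (Suc l)"
      using nat_first_change[of "\<lambda>j. e \<in> occ \<Phi> j" j k] p by metis
    then show False using created[of l e] p by auto
  qed
  have up_eq: "af_up ?C e = Some i" if "i < n" "e \<notin> occ \<Phi> i" "e \<in> occ \<Phi> (Suc i)" for i e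
  proof -
    have "(THE i. i < n \<and> e \<notin> occ \<Phi> i \<and> e \<in> occ \<Phi> (Suc i)) = i"
    proof (rule the_equality)
      fix i' assume i': "i' < n \<and> e \<notin> occ \<Phi> i' \<and> e \<in> occ \<Phi> (Suc i')"
      show "i' = i"
        using created[of i' e] created[of i e] i' that
        by (cases i i' rule: linorder_cases) auto
    qed (use that in auto)
    moreover have "e \<notin> occ \<Phi> 0" using created[OF that] by auto
    ultimately show ?thesis by (simp add: flow_of_def Let_def defs)
  qed
  have lo_eq: "af_lo ?C e = Some i" if "i < n" "e \<in> occ \<Phi> i" "e \<notin> occ \<Phi> (Suc i)" for i e
  proof -
    have "(THE i. i < n \<and> e \<in> occ \<Phi> i \<and> e \<notin> occ \<Phi> (Suc i)) = i"
    proof (rule the_equality)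
      fix i' assume i': "i' < n \<and> e \<in> occ \<Phi> i' \<and> e \<notin> occ \<Phi> (Suc i')"
      show "i' = i"
        using persist[where i = i and j = "Suc i" and k = i' and e = e]
          persist[where i = i' and j = "Suc i'" and k = i and e = e] i' that
        by (cases i i' rule: linorder_cases) auto
    qed (use that in auto)
    moreover have "e \<notin> occ \<Phi> n" using persist[where i = i and j = "Suc i" and k = n and e = e] that by auto
    ultimately show ?thesis by (simp add: flow_of_def Let_def defs)
  qed
  have up_ex: "\<exists>i < n. e \<notin> occ \<Phi> i \<and> e \<in> occ \<Phi> (Suc i)" if e: "e \<in> af_edges ?C" "e \<notin> occ \<Phi> 0" for e
  proof -
    obtain k where k: "k \<le> n" "e \<in> occ \<Phi> k" using e by (auto simp: flow_of_def Let_def defs)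
    obtain i where "i < k" "e \<notin> occ \<Phi> i" "e \<in> occ \<Phi> (Suc i)"
      using nat_first_change[of "\<lambda>j. e \<in> occ \<Phi> j" 0 k, OF e(2) k(2)] by blast
    then show ?thesis using k by (intro exI[of _ i]) auto
  qed
  have lo_ex: "\<exists>i < n. e \<in> occ \<Phi> i \<and> e \<notin> occ \<Phi> (Suc i)" if e: "e \<in> af_edges ?C" "e \<notin> occ \<Phi> n" for e
  proof -
    obtain k where k: "k \<le> n" "e \<in> occ \<Phi> k" using e by (auto simp: flow_of_def Let_def defs)
    obtain i where "i < n" "\<not> e \<notin> occ \<Phi> i" "e \<notin> occ \<Phi> (Suc i)"
      using nat_first_change[of "\<lambda>j. e \<notin> occ \<Phi> j" k n] e(2) k by blast
    then show ?thesis by auto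
  qed
  have edges: "af_edges ?C = (\<Union>i \<le> n. occ \<Phi> i)" by (simp add: flow_of_def Let_def defs)
  have verts: "af_verts ?C = {i. i < n \<and> ks ! i \<noteq> None}" by (simp add: flow_of_def Let_def defs)
  have from_None: "edges_from ?C None = occ \<Phi> 0"
    by (auto simp: edges_from_def edges) (auto simp: flow_of_def Let_def defs split: if_splits)
  have to_None: "edges_to ?C None = occ \<Phi> n"
    by (auto simp: edges_to_def edges) (auto simp: flow_of_def Let_def defs split: if_splits)
  have up_None: "e \<in> occ \<Phi> 0 \<Longrightarrow> af_up ?C e = None" and lo_None: "e \<in> occ \<Phi> n \<Longrightarrow> af_lo ?C e = None"
    for e by (auto simp: flow_of_def Let_def defs)
  have from_Some: "edges_from ?C (Some i) = occ \<Phi> (Suc i) - occ \<Phi> i" if "i < n" for i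
  proof
    show "edges_from ?C (Some i) \<subseteq> occ \<Phi> (Suc i) - occ \<Phi> i"
    proof
      fix e assume "e \<in> edges_from ?C (Some i)"
      then have e: "e \<in> af_edges ?C" "af_up ?C e = Some i" by (auto simp: edges_from_def)
      then have "e \<notin> occ \<Phi> 0" using up_None by auto
      with e(1) obtain j where j: "j < n" "e \<notin> occ \<Phi> j" "e \<in> occ \<Phi> (Suc j)" using up_ex by blast
      then show "e \<in> occ \<Phi> (Suc i) - occ \<Phi> i" using up_eq[OF j] e(2) by simp
    qed
    show "occ \<Phi> (Suc i) - occ \<Phi> i \<subseteq> edges_from ?C (Some i)"
      using that up_eq by (auto simp: edges_from_def edges intro!: bexI[of _ "Suc i"])
  qed
  have to_Some: "edges_to ?C (Some i) = occ \<Phi> i - occ \<Phi> (Suc i)" if "i < n" for i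
  proof
    show "edges_to ?C (Some i) \<subseteq> occ \<Phi> i - occ \<Phi> (Suc i)"
    proof
      fix e assume "e \<in> edges_to ?C (Some i)"
      then have e: "e \<in> af_edges ?C" "af_lo ?C e = Some i" by (auto simp: edges_to_def)
      then have "e \<notin> occ \<Phi> n" using lo_None by auto
      with e(1) obtain j where j: "j < n" "e \<in> occ \<Phi> j" "e \<notin> occ \<Phi> (Suc j)" using lo_ex by blast
      then show "e \<in> occ \<Phi> i - occ \<Phi> (Suc i)" using lo_eq[OF j] e(2) by simp
    qed
    show "occ \<Phi> i - occ \<Phi> (Suc i) \<subseteq> edges_to ?C (Some i)"
      using that lo_eq by (auto simp: edges_to_def edges intro!: bexI[of _ "i"])
  qed
  have wf: "flow_wf ?C"
    unfolding flow_wf_def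
  proof
    fix e assume e: "e \<in> af_edges ?C"
    have "af_up ?C e \<in> insert None (Some ` af_verts ?C)"
    proof (cases "e \<in> occ \<Phi> 0")
      case False
      then obtain j where j: "j < n" "e \<notin> occ \<Phi> j" "e \<in> occ \<Phi> (Suc j)" using up_ex[OF e] by blast
      then show ?thesis using up_eq[OF j] created[OF j] by (simp add: verts)
    qed (simp add: up_None)
    moreover have "af_lo ?C e \<in> insert None (Some ` af_verts ?C)"
    proof (cases "e \<in> occ \<Phi> n")
      case False
      then obtain j where j: "j < n" "e \<in> occ \<Phi> j" "e \<notin> occ \<Phi> (Suc j)" using lo_ex[OF e] by blast
      then show ?thesis using lo_eq[OF j] consumed[OF j] by (simp add: verts)
    qed (simp add: lo_None)
    ultimately show "af_up ?C e \<in> insert None (Some ` af_verts ?C) \<and>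
        af_lo ?C e \<in> insert None (Some ` af_verts ?C)" ..
  qed
  have der: "der bar ?C (fs ! i) (filter (\<lambda>j. ks ! j \<noteq> None) [i..<n]) (fs ! n)" if "i \<le> n" for i
    using that
  proof (induction rule: inc_induct)
    case base
    show ?case by (simp add: der_refl)
  next
    case (step i)
    from steps[OF step.hyps(2)] obtain \<xi> \<alpha> \<beta> where st: "fs ! i = plug \<xi> \<alpha>" "fs ! Suc i = plug \<xi> \<beta>"
      "case ks ! i of None \<Rightarrow> struct_ax \<alpha> \<beta>
        | Some k \<Rightarrow> atomic_ax bar k \<alpha> \<beta> \<and> set (labels \<beta>) \<inter> (\<Union>j \<le> i. occ \<Phi> j) = {}"
      by auto
    have upt: "[i..<n] = i # [Suc i..<n]" using step.hyps by (simp add: upt_conv_Cons)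
    show ?case
    proof (cases "ks ! i")
      case None
      then show ?thesis using st step.IH upt by (simp add: der_struct_step)
    next
      case (Some k)
      then have fresh: "set (labels \<beta>) \<inter> occ \<Phi> i = {}" and ax: "atomic_ax bar k \<alpha> \<beta>" using st by auto
      \<comment> \<open>Distinct labels keep those of the redex out of the context, so they really
        vanish in this step; freshness does the same for the contractum.\<close>
      have "set (labels \<alpha>) = occ \<Phi> i - occ \<Phi> (Suc i)" "set (labels \<beta>) = occ \<Phi> (Suc i) - occ \<Phi> i"
        using fresh dist[of i] dist[of "Suc i"] step.hyps st
        by (auto simp: occ set_labels_plug distinct_labels_plug)
      moreover have "af_lbl ?C i = k" using Some by (simp add: flow_of_def Let_def defs)
      ultimately have "step_at bar ?C i \<alpha> \<beta>"
        using ax step.hyps by (simp add: step_at_def from_Some to_Some)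
      then show ?thesis using st step.IH upt Some by (simp add: der_atomic_step)
    qed
  qed
  have "realizes bar ?C (fs ! 0) (filter (\<lambda>j. ks ! j \<noteq> None) [0..<n]) (fs ! n)"
    unfolding realizes_def using der[of 0] wf dist[of 0]
    by (auto simp: from_None to_None occ verts)
  moreover have "erase (fs ! 0) = premiss \<Phi>"
    using len by (cases fs) (auto simp: premiss_def defs)
  moreover have "erase (fs ! n) = conclusion \<Phi>"
    using len last_conv_nth[of fs] by (cases fs) (auto simp: conclusion_def defs)
  ultimately show ?thesis unfolding realizable_def by blast
qed

section \<open>From derivations over a flow back to labelled derivations\<close>

definition chain_step ::
  "('a \<Rightarrow> 'a) \<Rightarrow> ('v, 'l) aflow \<Rightarrow> 'v option \<Rightarrow> ('a, 'l) lform \<Rightarrow> ('a, 'l) lform \<Rightarrow> bool" where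
  "chain_step bar C w x y \<longleftrightarrow> (\<exists>\<xi> \<alpha> \<beta>. x = plug \<xi> \<alpha> \<and> y = plug \<xi> \<beta> \<and>
     (case w of None \<Rightarrow> struct_ax \<alpha> \<beta> | Some v \<Rightarrow> step_at bar C v \<alpha> \<beta>))"

text \<open>The vertex list of \<open>der\<close> omits structural steps, whereas the vertices of
  \<open>flow_of\<close> are positions in the whole derivation. The list \<open>ws\<close> restores
  these positions, with \<open>None\<close> for structural steps.\<close>

lemma der_chain:
  assumes "der bar C x vs y"
  obtains fs ws where "length fs = Suc (length ws)" "fs ! 0 = x" "fs ! length ws = y"
    "vs = List.map_filter id ws" "\<And>i. i < length ws \<Longrightarrow> chain_step bar C (ws ! i) (fs ! i) (fs ! Suc i)"
proof -
  have "\<exists>fs ws. length fs = Suc (length ws) \<and> fs ! 0 = x \<and> fs ! length ws = y \<and>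
    vs = List.map_filter id ws \<and> (\<forall>i < length ws. chain_step bar C (ws ! i) (fs ! i) (fs ! Suc i))"
    using assms
  proof (induction rule: der.induct)
    case (der_refl x)
    show ?case by (rule exI[of _ "[x]"], rule exI[of _ "[]"]) (simp add: List.map_filter_def)
  next
    case (der_struct_step \<alpha> \<beta> \<xi> vs x)
    then obtain fs ws where *: "length fs = Suc (length ws)" "fs ! 0 = plug \<xi> \<beta>" "fs ! length ws = x"
      "vs = List.map_filter id ws" "\<forall>i < length ws. chain_step bar C (ws ! i) (fs ! i) (fs ! Suc i)"
      by blast
    have "chain_step bar C None (plug \<xi> \<alpha>) (plug \<xi> \<beta>)"
      using der_struct_step.hyps by (auto simp: chain_step_def)
    with * show ?case
      by (intro exI[of _ "plug \<xi> \<alpha> # fs"] exI[of _ "None # ws"])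
        (auto simp: List.map_filter_def nth_Cons split: nat.splits)
  next
    case (der_atomic_step v \<alpha> \<beta> \<xi> vs x)
    then obtain fs ws where *: "length fs = Suc (length ws)" "fs ! 0 = plug \<xi> \<beta>" "fs ! length ws = x"
      "vs = List.map_filter id ws" "\<forall>i < length ws. chain_step bar C (ws ! i) (fs ! i) (fs ! Suc i)"
      by blast
    have "chain_step bar C (Some v) (plug \<xi> \<alpha>) (plug \<xi> \<beta>)"
      using der_atomic_step.hyps by (auto simp: chain_step_def)
    with * show ?case
      by (intro exI[of _ "plug \<xi> \<alpha> # fs"] exI[of _ "Some v # ws"])
        (auto simp: List.map_filter_def nth_Cons split: nat.splits)
  qed
  with that show ?thesis by blast
qed

lemma set_map_filter_id: "set (List.map_filter id ws) = {v. Some v \<in> set ws}"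
  by (auto simp: List.map_filter_def image_iff) force

lemma distinct_map_filter_id:
  assumes "distinct (List.map_filter id ws)" "i < length ws" "j < length ws"
    "ws ! i = Some v" "ws ! j = Some v"
  shows "i = j"
  using assms
proof (induction ws arbitrary: i j)
  case (Cons w ws)
  have d: "distinct (List.map_filter id ws)"
    using Cons.prems(1) by (auto simp: List.map_filter_def comp_def split: if_splits)
  have n: "Some v \<notin> set ws" if "w = Some v"
    using Cons.prems(1) that set_map_filter_id[of ws] by (auto simp: List.map_filter_def)
  show ?case
    using Cons.IH[OF d] Cons.prems(2-) n nth_mem[of "i - 1" ws] nth_mem[of "j - 1" ws]
    by (cases i; cases j) auto
qed simp

text \<open>The prescribed flow supplies what \<open>is_deriv\<close> asks for: an edge has one
  upper end and each vertex is used once, so no label can be created twice.\<close>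

lemma realizable_deriv:
  fixes C :: "('v, 'e) aflow" and bar :: "'a \<Rightarrow> 'a"
  assumes "realizable bar C P Q"
  obtains \<Psi> :: "('a, 'e) deriv" where "is_deriv bar \<Psi>" "flow_iso (flow_of \<Psi>) C" "premiss \<Psi> = P" "conclusion \<Psi> = Q"
proof -
  obtain x vs y where r: "realizes bar C x vs y" and PQ: "erase x = P" "erase y = Q"
    using assms by (auto simp: realizable_def)
  then have "der bar C x vs y" and vs: "distinct vs" "set vs = af_verts C"
    and lx: "distinct (labels x)" "set (labels x) = edges_from C None"
    and ly: "set (labels y) = edges_to C None" and wf: "flow_wf C"
    by (auto simp: realizes_def)
  then obtain fs ws where len: "length fs = Suc (length ws)" and x: "fs ! 0 = x"
    and y: "fs ! length ws = y" and vs_ws: "vs = List.map_filter id ws"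
    and ch: "\<And>i. i < length ws \<Longrightarrow> chain_step bar C (ws ! i) (fs ! i) (fs ! Suc i)"
    using der_chain by blast
  define n where "n = length ws"
  define \<Psi> where "\<Psi> = (fs, map (map_option (af_lbl C)) ws)"
  have uniq: "i = j" if "i < n" "j < n" "ws ! i = Some v" "ws ! j = Some v" for i j v
    using distinct_map_filter_id[of ws i j v] that vs(1) unfolding vs_ws n_def by blast
  have in_verts: "v \<in> af_verts C \<longleftrightarrow> (\<exists>i < n. ws ! i = Some v)" for v
    using vs(2) unfolding vs_ws set_map_filter_id n_def by (auto simp: in_set_conv_nth)
  have occ: "occ \<Psi> i = set (labels (fs ! i))" for i by (simp add: occ_def \<Psi>_def)
  have lower: "edges_from C (Some v) \<subseteq> occ \<Psi> (Suc i)" "edges_to C (Some v) \<subseteq> occ \<Psi> i"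
    if "i < n" "ws ! i = Some v" for i v
    using ch[of i] that by (auto simp: n_def occ chain_step_def step_at_def set_labels_plug)
  have created: "\<exists>v. ws ! i = Some v \<and> e \<in> edges_from C (Some v)"
    if "i < n" "e \<notin> occ \<Psi> i" "e \<in> occ \<Psi> (Suc i)" for i e
    using ch[of i] that
    by (auto simp: n_def occ chain_step_def step_at_def set_labels_plug dest: struct_ax_labels
        split: option.splits)
  have consumed: "\<exists>v. ws ! i = Some v \<and> e \<in> edges_to C (Some v)"
    if "i < n" "e \<in> occ \<Psi> i" "e \<notin> occ \<Psi> (Suc i)" for i e
    using ch[of i] that
    by (auto simp: n_def occ chain_step_def step_at_def set_labels_plug dest: struct_ax_labels
        split: option.splits)
  have occ0: "occ \<Psi> 0 = edges_from C None" and occn: "occ \<Psi> n = edges_to C None"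
    using x y lx ly by (auto simp: occ n_def)
  have origin: "e \<in> edges_from C None \<or> (\<exists>j < i. \<exists>v. ws ! j = Some v \<and> e \<in> edges_from C (Some v))"
    if "e \<in> occ \<Psi> i" "i \<le> n" for e i
    using that
  proof (induction i)
    case (Suc i)
    show ?case
    proof (cases "e \<in> occ \<Psi> i")
      case True
      then show ?thesis using Suc by (auto intro: less_SucI)
    next
      case False
      then show ?thesis using created[of i e] Suc.prems by auto
    qed
  qed (simp add: occ0)
  \<comment> \<open>An earlier occurrence goes back to the premiss or to an earlier step. Since
    \<open>af_up\<close> is a function, that step would have to use the same vertex
    \<open>v\<close>, against \<open>uniq\<close>.\<close>
  have fresh: "edges_from C (Some v) \<inter> (\<Union>j \<le> i. occ \<Psi> j) = {}" if "i < n" "ws ! i = Some v" for i v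
  proof (rule ccontr)
    assume "\<not> ?thesis"
    then obtain e j where e: "e \<in> edges_from C (Some v)" and "j \<le> i" "e \<in> occ \<Psi> j" by auto
    moreover from this have "j \<le> n" using that by simp
    ultimately obtain k v' where "k < j" "ws ! k = Some v'" "e \<in> edges_from C (Some v')"
      using origin[of e j] by (auto simp: edges_from_def)
    then show False using uniq[of i k v] e \<open>j \<le> i\<close> that by (auto simp: edges_from_def)
  qed
  have der: "is_deriv bar \<Psi>"
    unfolding is_deriv_def Let_def
  proof (intro conjI allI impI)
    show "length (fst \<Psi>) = Suc (length (snd \<Psi>))" using len by (simp add: \<Psi>_def)
    show "distinct (labels (fst \<Psi> ! 0))" using x lx by (simp add: \<Psi>_def)
    fix i assume "i < length (snd \<Psi>)"
    then have i: "i < n" by (simp add: \<Psi>_def n_def)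
    then obtain \<xi> \<alpha> \<beta> where st: "fs ! i = plug \<xi> \<alpha>" "fs ! Suc i = plug \<xi> \<beta>"
      "case ws ! i of None \<Rightarrow> struct_ax \<alpha> \<beta> | Some v \<Rightarrow> step_at bar C v \<alpha> \<beta>"
      using ch[of i] by (auto simp: chain_step_def n_def)
    have "case snd \<Psi> ! i of None \<Rightarrow> struct_ax \<alpha> \<beta>
      | Some k \<Rightarrow> atomic_ax bar k \<alpha> \<beta> \<and> set (labels \<beta>) \<inter> (\<Union>j \<le> i. occ \<Psi> j) = {}"
      using st(3) i fresh[OF i] by (cases "ws ! i") (auto simp: \<Psi>_def n_def step_at_def)
    then show "\<exists>\<xi> \<alpha> \<beta>. fst \<Psi> ! i = plug \<xi> \<alpha> \<and> fst \<Psi> ! Suc i = plug \<xi> \<beta> \<and>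
      (case snd \<Psi> ! i of None \<Rightarrow> struct_ax \<alpha> \<beta>
       | Some k \<Rightarrow> atomic_ax bar k \<alpha> \<beta> \<and> set (labels \<beta>) \<inter> (\<Union>j \<le> i. occ \<Psi> j) = {})"
      using st(1,2) unfolding \<Psi>_def fst_conv by blast
  qed
  have edges: "(\<Union>i \<le> n. occ \<Psi> i) = af_edges C"
  proof
    show "(\<Union>i \<le> n. occ \<Psi> i) \<subseteq> af_edges C" using origin by (fastforce simp: edges_from_def)
    show "af_edges C \<subseteq> (\<Union>i \<le> n. occ \<Psi> i)"
    proof
      fix e assume e: "e \<in> af_edges C"
      show "e \<in> (\<Union>i \<le> n. occ \<Psi> i)"
      proof (cases "af_up C e")
        case None
        then have "e \<in> occ \<Psi> 0" using e by (simp add: occ0 edges_from_def)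
        then show ?thesis by blast
      next
        case (Some v)
        \<comment> \<open>Well-formedness makes the upper end a vertex, hence some step uses it and
          the edge occurs right after that step.\<close>
        then have "v \<in> af_verts C" using e wf by (auto simp: flow_wf_def)
        then obtain i where "i < n" "ws ! i = Some v" using in_verts by auto
        moreover have "e \<in> edges_from C (Some v)" using e Some by (simp add: edges_from_def)
        ultimately have "e \<in> occ \<Psi> (Suc i)" "Suc i \<le> n" using lower[of i v] by auto
        then show ?thesis by blast
      qed
    qed
  qed
  have len_ks: "length (snd \<Psi>) = n" by (simp add: \<Psi>_def n_def)
  have up: "map_option (\<lambda>i. the (ws ! i)) (af_up (flow_of \<Psi>) e) = af_up C e" if e: "e \<in> af_edges C" for e
  proof (cases "e \<in> occ \<Psi> 0")
    case True
    then show ?thesis using occ0 by (simp add: flow_of_def Let_def edges_from_def)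
  next
    case False
    obtain k where "k \<le> n" "e \<in> occ \<Psi> k" using e edges by auto
    then obtain i where i: "i < n" "e \<notin> occ \<Psi> i" "e \<in> occ \<Psi> (Suc i)"
      using nat_first_change[of "\<lambda>j. e \<in> occ \<Psi> j" 0 k] False by (metis le0 less_le_trans)
    have "(THE i. i < n \<and> e \<notin> occ \<Psi> i \<and> e \<in> occ \<Psi> (Suc i)) = i"
    proof (rule the_equality)
      fix j assume j: "j < n \<and> e \<notin> occ \<Psi> j \<and> e \<in> occ \<Psi> (Suc j)"
      show "j = i" using created[of i e] created[of j e] i j uniq[of j i] by (auto simp: edges_from_def)
    qed (use i in auto)
    then have "af_up (flow_of \<Psi>) e = Some i" using False by (simp add: flow_of_def Let_def len_ks)
    then show ?thesis using created[OF i] by (auto simp: edges_from_def)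
  qed
  have lo: "map_option (\<lambda>i. the (ws ! i)) (af_lo (flow_of \<Psi>) e) = af_lo C e" if e: "e \<in> af_edges C" for e
  proof (cases "e \<in> occ \<Psi> n")
    case True
    then show ?thesis using occn by (simp add: flow_of_def Let_def edges_to_def len_ks)
  next
    case False
    obtain k where "k \<le> n" "e \<in> occ \<Psi> k" using e edges by auto
    then obtain i where i: "i < n" "e \<in> occ \<Psi> i" "e \<notin> occ \<Psi> (Suc i)"
      using nat_first_change[of "\<lambda>j. e \<notin> occ \<Psi> j" k n] False by metis
    have "(THE i. i < n \<and> e \<in> occ \<Psi> i \<and> e \<notin> occ \<Psi> (Suc i)) = i"
    proof (rule the_equality)
      fix j assume j: "j < n \<and> e \<in> occ \<Psi> j \<and> e \<notin> occ \<Psi> (Suc j)"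
      show "j = i" using consumed[of i e] consumed[of j e] i j uniq[of j i] by (auto simp: edges_to_def)
    qed (use i in auto)
    then have "af_lo (flow_of \<Psi>) e = Some i" using False by (simp add: flow_of_def Let_def len_ks)
    then show ?thesis using consumed[OF i] by (auto simp: edges_to_def)
  qed
  have verts: "af_verts (flow_of \<Psi>) = {i. i < n \<and> ws ! i \<noteq> None}"
    by (auto simp: flow_of_def Let_def \<Psi>_def n_def)
  have "flow_iso (flow_of \<Psi>) C"
    unfolding flow_iso_def
  \<comment> \<open>Labels already are the edges of \<open>C\<close>, so only vertices are renamed:
    a step number goes to the vertex used at that step.\<close>
  proof (intro exI[of _ "\<lambda>i. the (ws ! i)"] exI[of _ id] conjI)
    show "bij_betw (\<lambda>i. the (ws ! i)) (af_verts (flow_of \<Psi>)) (af_verts C)"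
      unfolding bij_betw_def verts
    proof
      show "inj_on (\<lambda>i. the (ws ! i)) {i. i < n \<and> ws ! i \<noteq> None}"
        using uniq by (auto simp: inj_on_def)
      show "(\<lambda>i. the (ws ! i)) ` {i. i < n \<and> ws ! i \<noteq> None} = af_verts C"
        using in_verts by (force simp: image_iff)
    qed
    have E: "af_edges (flow_of \<Psi>) = af_edges C"
      using edges by (simp add: flow_of_def Let_def len_ks)
    then show "bij_betw id (af_edges (flow_of \<Psi>)) (af_edges C)" by simp
    show "\<forall>v \<in> af_verts (flow_of \<Psi>). af_lbl C (the (ws ! v)) = af_lbl (flow_of \<Psi>) v"
      unfolding verts by (auto simp: flow_of_def Let_def \<Psi>_def n_def)
    show "\<forall>e \<in> af_edges (flow_of \<Psi>).
        af_up C (id e) = map_option (\<lambda>i. the (ws ! i)) (af_up (flow_of \<Psi>) e) \<and>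
        af_lo C (id e) = map_option (\<lambda>i. the (ws ! i)) (af_lo (flow_of \<Psi>) e)"
      unfolding E using up lo by simp
  qed
  moreover have "fs \<noteq> []" using len by auto
  then have "premiss \<Psi> = P" "conclusion \<Psi> = Q"
    using x y PQ len hd_conv_nth[of fs] last_conv_nth[of fs]
    by (auto simp: premiss_def conclusion_def \<Psi>_def)
  ultimately show ?thesis using that der by blast
qed

section \<open>Replacement of a pattern\<close>

text \<open>Redirected and new edges end only at new vertices, so a retained vertex, like the
  boundary, loses at most the deleted edges and gains none.\<close>

lemma edges_at_replace_retained:
  assumes "x \<in> insert None (Some ` (af_verts C - S))"
    and "\<forall>e \<in> af_edges C - DE. \<forall>v \<in> S. af_up C e = Some v \<longrightarrow> rup e \<in> Some ` range Inr"
    and "\<forall>e \<in> af_edges C - DE. \<forall>v \<in> S. af_lo C e = Some v \<longrightarrow> rlo e \<in> Some ` range Inr"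
    and "\<forall>j < ne. nup j \<in> Some ` range Inr" and "\<forall>j < ne. nlo j \<in> Some ` range Inr"
  shows "edges_from (replace C S DE nl nv ne nup nlo rup rlo) (map_option Inl x) =
           Inl ` (edges_from C x - DE)"
    and "edges_to (replace C S DE nl nv ne nup nlo rup rlo) (map_option Inl x) =
           Inl ` (edges_to C x - DE)"
proof -
  have up: "rup e \<noteq> map_option Inl x" if "e \<in> af_edges C" "e \<notin> DE" "v \<in> S" "af_up C e = Some v" for e v
    using assms(2) that by (cases x) fastforce+
  have lo: "rlo e \<noteq> map_option Inl x" if "e \<in> af_edges C" "e \<notin> DE" "v \<in> S" "af_lo C e = Some v" for e v
    using assms(3) that by (cases x) fastforce+
  have n: "nup j \<noteq> map_option Inl x" "nlo j \<noteq> map_option Inl x" if "j < ne" for j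
    using assms(4,5) that by (cases x; fastforce)+
  have x: "x \<noteq> Some v" if "v \<in> S" for v
    using assms(1) that by auto
  let ?R = "replace C S DE nl nv ne nup nlo rup rlo"
  have "af_up ?R (Inl e) = map_option Inl x \<longleftrightarrow> af_up C e = x" if "e \<in> af_edges C - DE" for e
    using up[of e] x that by (cases "af_up C e"; cases x) (auto simp: replace_def)
  then show "edges_from ?R (map_option Inl x) = Inl ` (edges_from C x - DE)"
    using n by (auto simp: edges_from_def replace_def image_iff)
  have "af_lo ?R (Inl e) = map_option Inl x \<longleftrightarrow> af_lo C e = x" if "e \<in> af_edges C - DE" for e
    using lo[of e] x that by (cases "af_lo C e"; cases x) (auto simp: replace_def)
  then show "edges_to ?R (map_option Inl x) = Inl ` (edges_to C x - DE)"
    using n by (auto simp: edges_to_def replace_def image_iff)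
qed

lemma edges_at_replace_new:
  "edges_from (replace C S DE nl nv ne nup nlo rup rlo) (Some (Inr j)) =
     Inl ` {e \<in> (\<Union>v \<in> S. edges_from C (Some v)) - DE. rup e = Some (Inr j)} \<union>
     Inr ` {i \<in> {..<ne}. nup i = Some (Inr j)}"
  "edges_to (replace C S DE nl nv ne nup nlo rup rlo) (Some (Inr j)) =
     Inl ` {e \<in> (\<Union>v \<in> S. edges_to C (Some v)) - DE. rlo e = Some (Inr j)} \<union>
     Inr ` {i \<in> {..<ne}. nlo i = Some (Inr j)}"
  by (auto simp: edges_from_def edges_to_def replace_def split: option.splits if_splits)

text \<open>Covers the eight rules that delete only the edge from \<open>p\<close> down to
  \<open>q\<close>. Each occurrence of that edge carrying atom \<open>b\<close> becomes
  \<open>F b\<close>; the two steps at \<open>p\<close> and \<open>q\<close> are replaced by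
  derivations whose vertices \<open>ps\<close> and \<open>qs\<close> together exhaust the new
  vertices. As both ends of the edge lie in the pattern, no other step sees the
  substitution.\<close>

lemma realizable_replace:
  fixes C :: "('v, 'e) aflow"
  assumes real: "realizable bar C P Q"
    and pq: "p \<in> af_verts C" "q \<in> af_verts C" "p \<noteq> q"
    and \<epsilon>: "af_up C \<epsilon> = Some p" "af_lo C \<epsilon> = Some q"
    and R: "R = replace C {p, q} {\<epsilon>} nl nv ne nup nlo rup rlo"
    and rup: "\<And>e. e \<in> edges_from C (Some p) \<union> edges_from C (Some q) \<Longrightarrow> e \<noteq> \<epsilon> \<Longrightarrow>
                 rup e \<in> Some ` Inr ` {..<nv}"
    and rlo: "\<And>e. e \<in> edges_to C (Some p) \<union> edges_to C (Some q) \<Longrightarrow> e \<noteq> \<epsilon> \<Longrightarrow>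
                 rlo e \<in> Some ` Inr ` {..<nv}"
    and new: "\<And>j. j < ne \<Longrightarrow> nup j \<in> Some ` Inr ` {..<nv} \<and> nlo j \<in> Some ` Inr ` {..<nv}"
    and f: "f = (\<lambda>b e. if e = \<epsilon> then F b else At b (Inl e))"
    and ps: "distinct (ps @ qs)" "set (ps @ qs) = Inr ` {..<nv}"
    and derp: "\<And>\<alpha> \<beta>. step_at bar C p \<alpha> \<beta> \<Longrightarrow> der bar R (lsubst f \<alpha>) ps (lsubst f \<beta>)"
    and derq: "\<And>\<alpha> \<beta>. step_at bar C q \<alpha> \<beta> \<Longrightarrow> der bar R (lsubst f \<alpha>) qs (lsubst f \<beta>)"
  shows "realizable bar R P Q"
proof -
  let ?T = "\<lambda>v. if v = p then ps else if v = q then qs else [Inl v]"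
  have wf: "flow_wf C" using real by (rule realizable_flow_wf)
  have rup': "\<forall>e \<in> af_edges C - {\<epsilon>}. \<forall>v \<in> {p, q}. af_up C e = Some v \<longrightarrow> rup e \<in> Some ` Inr ` {..<nv}"
    using rup by (auto simp: edges_from_def)
  have rlo': "\<forall>e \<in> af_edges C - {\<epsilon>}. \<forall>v \<in> {p, q}. af_lo C e = Some v \<longrightarrow> rlo e \<in> Some ` Inr ` {..<nv}"
    using rlo by (auto simp: edges_to_def)
  have wfR: "flow_wf R"
    unfolding flow_wf_def
  proof
    fix e assume "e \<in> af_edges R"
    then consider e0 where "e = Inl e0" "e0 \<in> af_edges C - {\<epsilon>}" | j where "e = Inr j" "j < ne"
      by (auto simp: R replace_def)
    then show "af_up R e \<in> insert None (Some ` af_verts R) \<and> af_lo R e \<in> insert None (Some ` af_verts R)"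
    proof cases
      case 1
      have *: "af_up C e0 \<in> insert None (Some ` af_verts C)" "af_lo C e0 \<in> insert None (Some ` af_verts C)"
        using wf 1 by (auto simp: flow_wf_def)
      have "af_up R e \<in> insert None (Some ` af_verts R)"
        using * 1 bspec[OF rup', of e0]
        by (auto simp: R replace_def split: if_splits)
      moreover have "af_lo R e \<in> insert None (Some ` af_verts R)"
        using * 1 bspec[OF rlo', of e0]
        by (auto simp: R replace_def split: if_splits)
      ultimately show ?thesis ..
    next
      case 2
      then show ?thesis using new[of j] by (auto simp: R replace_def)
    qed
  qed
  have bnd: "edges_from R (map_option Inl x) = Inl ` edges_from C x \<and>
      edges_to R (map_option Inl x) = Inl ` edges_to C x \<and> inj_on Inl (edges_from C x) \<and>
      (\<forall>e \<in> edges_from C x \<union> edges_to C x. \<forall>b. f b e = At b (Inl e))"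
    if "x \<in> insert None (Some ` (af_verts C - {p, q}))" for x
  proof -
    have n: "\<epsilon> \<notin> edges_from C x" "\<epsilon> \<notin> edges_to C x"
      using that \<epsilon> by (auto simp: edges_from_def edges_to_def)
    have "edges_from R (map_option Inl x) = Inl ` (edges_from C x - {\<epsilon>})"
      "edges_to R (map_option Inl x) = Inl ` (edges_to C x - {\<epsilon>})"
      unfolding R using rup' rlo' new
      by (intro edges_at_replace_retained[OF that]; blast)+
    with n show ?thesis by (auto simp: f)
  qed
  show ?thesis
  proof (rule realizable_lsubst[where S = "{p, q}" and T = ?T, OF real wfR bnd])
    show "(\<Union>v \<in> af_verts C. set (?T v)) = af_verts R"
    proof -
      have V: "af_verts C = insert p (insert q (af_verts C - {p, q}))" using pq by auto
      have "(\<Union>v \<in> af_verts C. set (?T v)) = set (ps @ qs) \<union> Inl ` (af_verts C - {p, q})"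
        by (subst V) (use pq(3) in auto)
      then show ?thesis unfolding ps(2) by (auto simp: R replace_def)
    qed
    show "set (?T v) \<inter> set (?T w) = {}" if "v \<in> af_verts C" "w \<in> af_verts C" "v \<noteq> w" for v w
    proof -
      have "Inl u \<notin> set ps" "Inl u \<notin> set qs" for u using ps(2) by auto
      then show ?thesis using ps(1) that by auto
    qed
  qed (use derp derq ps in \<open>auto simp: R replace_def\<close>)
qed

section \<open>Edges at a vertex, read off from its arity\<close>

lemma atomic_flow_edges_to:
  assumes "atomic_flow C" and "v \<in> af_verts C"
  shows "fst (arity (af_lbl C v)) = 0 \<Longrightarrow> edges_to C (Some v) = {}"
    and "fst (arity (af_lbl C v)) = 1 \<Longrightarrow> e \<in> edges_to C (Some v) \<Longrightarrow> edges_to C (Some v) = {e}"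
    and "fst (arity (af_lbl C v)) = 2 \<Longrightarrow> e \<in> edges_to C (Some v) \<Longrightarrow> e' \<in> edges_to C (Some v) \<Longrightarrow>
           e \<noteq> e' \<Longrightarrow> edges_to C (Some v) = {e, e'}"
proof -
  have *: "finite (edges_to C (Some v))" "card (edges_to C (Some v)) = fst (arity (af_lbl C v))"
    using assms by (auto simp: atomic_flow_def upper_edges_def edges_to_def)
  show "fst (arity (af_lbl C v)) = 0 \<Longrightarrow> edges_to C (Some v) = {}" using * by simp
  show "fst (arity (af_lbl C v)) = 1 \<Longrightarrow> e \<in> edges_to C (Some v) \<Longrightarrow> edges_to C (Some v) = {e}"
    using * by (auto simp: card_1_singleton_iff)
  show "fst (arity (af_lbl C v)) = 2 \<Longrightarrow> e \<in> edges_to C (Some v) \<Longrightarrow> e' \<in> edges_to C (Some v) \<Longrightarrow>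
      e \<noteq> e' \<Longrightarrow> edges_to C (Some v) = {e, e'}"
    using * by (auto simp: card_2_iff)
qed

lemma atomic_flow_edges_from:
  assumes "atomic_flow C" and "v \<in> af_verts C"
  shows "snd (arity (af_lbl C v)) = 0 \<Longrightarrow> edges_from C (Some v) = {}"
    and "snd (arity (af_lbl C v)) = 1 \<Longrightarrow> e \<in> edges_from C (Some v) \<Longrightarrow> edges_from C (Some v) = {e}"
    and "snd (arity (af_lbl C v)) = 2 \<Longrightarrow> e \<in> edges_from C (Some v) \<Longrightarrow> e' \<in> edges_from C (Some v) \<Longrightarrow>
           e \<noteq> e' \<Longrightarrow> edges_from C (Some v) = {e, e'}"
proof -
  have *: "finite (edges_from C (Some v))" "card (edges_from C (Some v)) = snd (arity (af_lbl C v))"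
    using assms by (auto simp: atomic_flow_def lower_edges_def edges_from_def)
  show "snd (arity (af_lbl C v)) = 0 \<Longrightarrow> edges_from C (Some v) = {}" using * by simp
  show "snd (arity (af_lbl C v)) = 1 \<Longrightarrow> e \<in> edges_from C (Some v) \<Longrightarrow> edges_from C (Some v) = {e}"
    using * by (auto simp: card_1_singleton_iff)
  show "snd (arity (af_lbl C v)) = 2 \<Longrightarrow> e \<in> edges_from C (Some v) \<Longrightarrow> e' \<in> edges_from C (Some v) \<Longrightarrow>
      e \<noteq> e' \<Longrightarrow> edges_from C (Some v) = {e, e'}"
    using * by (auto simp: card_2_iff)
qed

lemma weakening_edges:
  assumes "atomic_flow C" "v \<in> af_verts C" "af_lbl C v = Wv" "e \<in> af_edges C" "af_up C e = Some v"
  shows "edges_to C (Some v) = {}" "edges_from C (Some v) = {e}"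
  using assms atomic_flow_edges_to(1)[of C v] atomic_flow_edges_from(2)[of C v e]
  by (auto simp: edges_from_def)

lemma coweakening_edges:
  assumes "atomic_flow C" "v \<in> af_verts C" "af_lbl C v = CoWv" "e \<in> af_edges C" "af_lo C e = Some v"
  shows "edges_to C (Some v) = {e}" "edges_from C (Some v) = {}"
  using assms atomic_flow_edges_to(2)[of C v e] atomic_flow_edges_from(1)[of C v]
  by (auto simp: edges_to_def)

lemma interaction_edges:
  assumes "atomic_flow C" "v \<in> af_verts C" "af_lbl C v = Iv"
    "e \<in> af_edges C" "af_up C e = Some v" "e' \<in> af_edges C" "af_up C e' = Some v" "e \<noteq> e'"
  shows "edges_to C (Some v) = {}" "edges_from C (Some v) = {e, e'}"
  using assms atomic_flow_edges_to(1)[of C v] atomic_flow_edges_from(3)[of C v e e']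
  by (auto simp: edges_from_def)

lemma cut_edges:
  assumes "atomic_flow C" "v \<in> af_verts C" "af_lbl C v = Cutv"
    "e \<in> af_edges C" "af_lo C e = Some v" "e' \<in> af_edges C" "af_lo C e' = Some v" "e \<noteq> e'"
  shows "edges_to C (Some v) = {e, e'}" "edges_from C (Some v) = {}"
  using assms atomic_flow_edges_to(3)[of C v e e'] atomic_flow_edges_from(1)[of C v]
  by (auto simp: edges_to_def)

lemma contraction_edges:
  assumes "atomic_flow C" "v \<in> af_verts C" "af_lbl C v = Cv"
    "e \<in> af_edges C" "af_lo C e = Some v" "e' \<in> af_edges C" "af_lo C e' = Some v" "e \<noteq> e'"
    "d \<in> af_edges C" "af_up C d = Some v"
  shows "edges_to C (Some v) = {e, e'}" "edges_from C (Some v) = {d}"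
  using assms atomic_flow_edges_to(3)[of C v e e'] atomic_flow_edges_from(2)[of C v d]
  by (auto simp: edges_to_def edges_from_def)

lemma cocontraction_edges:
  assumes "atomic_flow C" "v \<in> af_verts C" "af_lbl C v = CoCv"
    "e \<in> af_edges C" "af_up C e = Some v" "e' \<in> af_edges C" "af_up C e' = Some v" "e \<noteq> e'"
    "d \<in> af_edges C" "af_lo C d = Some v"
  shows "edges_to C (Some v) = {d}" "edges_from C (Some v) = {e, e'}"
  using assms atomic_flow_edges_to(2)[of C v d] atomic_flow_edges_from(3)[of C v e e']
  by (auto simp: edges_to_def edges_from_def)

section \<open>Local derivations\<close>

text \<open>A calculational chain thus accumulates the vertex lists of its links in order.\<close>

lemmas [trans] = der_trans

lemma der_OrL: "der bar C x vs x' \<Longrightarrow> der bar C (Or x y) vs (Or x' y)"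
  using der_plug[of bar C x vs x' "OrL Hole y"] by simp

lemma der_OrR: "der bar C y vs y' \<Longrightarrow> der bar C (Or x y) vs (Or x y')"
  using der_plug[of bar C y vs y' "OrR x Hole"] by simp

lemma der_AndL: "der bar C x vs x' \<Longrightarrow> der bar C (And x y) vs (And x' y)"
  using der_plug[of bar C x vs x' "AndL Hole y"] by simp

lemma der_AndR: "der bar C y vs y' \<Longrightarrow> der bar C (And x y) vs (And x y')"
  using der_plug[of bar C y vs y' "AndR x Hole"] by simp

lemma der_Or_comm: "der bar C (Or x y) [] (Or y x)"
  and der_And_comm: "der bar C (And x y) [] (And y x)"
  and der_Or_assoc: "der bar C (Or (Or x y) z) [] (Or x (Or y z))"
  and der_And_assoc: "der bar C (And (And x y) z) [] (And x (And y z))"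
  and der_Or_Ff: "der bar C (Or x Ff) [] x" and der_Or_Ff': "der bar C x [] (Or x Ff)"
  and der_And_Tt: "der bar C (And x Tt) [] x" and der_And_Tt': "der bar C x [] (And x Tt)"
  and der_Or_Tt_Tt: "der bar C (Or Tt Tt) [] Tt" and der_Tt_Or_Tt: "der bar C Tt [] (Or Tt Tt)"
  and der_And_Ff_Ff: "der bar C Ff [] (And Ff Ff)"
  and der_switch: "der bar C (And x (Or y z)) [] (Or (And x y) z)"
  and der_medial: "der bar C (Or (And x y) (And z w)) [] (And (Or x z) (Or y w))"
  by (auto intro: der_eq der_struct struct_ax.intros eq_ax.intros)

lemma der_Ff_Tt: "der bar C Ff [] Tt"
proof -
  have "der bar C Ff [] (And Ff Tt)" by (rule der_And_Tt')
  \<comment> \<open>Splitting \<open>Tt\<close> provides the disjunction that switch needs: one copy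
    leaves the conjunction with \<open>Ff\<close>, and the unit equations finish.\<close>
  also have "der bar C \<dots> [] (And Ff (Or Tt Tt))" by (rule der_AndR, rule der_Tt_Or_Tt)
  also have "der bar C \<dots> [] (Or (And Ff Tt) Tt)" by (rule der_switch)
  also have "der bar C \<dots> [] (Or Ff Tt)" by (rule der_OrL, rule der_And_Tt)
  also have "der bar C \<dots> [] (Or Tt Ff)" by (rule der_Or_comm)
  also have "der bar C \<dots> [] Tt" by (rule der_Or_Ff)
  finally show ?thesis by simp
qed

lemma der_interaction:
  "af_lbl C v = Iv \<Longrightarrow> edges_to C (Some v) = {} \<Longrightarrow> edges_from C (Some v) = {e, e'} \<Longrightarrow> e \<noteq> e' \<Longrightarrow>
     der bar C Tt [v] (Or (At a e) (At (bar a) e'))"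
  by (rule der_atomic) (auto simp: step_at_def intro: atomic_ax.intros)

lemma der_cut:
  "af_lbl C v = Cutv \<Longrightarrow> edges_to C (Some v) = {e, e'} \<Longrightarrow> edges_from C (Some v) = {} \<Longrightarrow>
     der bar C (And (At a e) (At (bar a) e')) [v] Ff"
  by (rule der_atomic) (auto simp: step_at_def intro: atomic_ax.intros)

lemma der_weakening:
  "af_lbl C v = Wv \<Longrightarrow> edges_to C (Some v) = {} \<Longrightarrow> edges_from C (Some v) = {e} \<Longrightarrow>
     der bar C Ff [v] (At a e)"
  by (rule der_atomic) (auto simp: step_at_def intro: atomic_ax.intros)

lemma der_coweakening:
  "af_lbl C v = CoWv \<Longrightarrow> edges_to C (Some v) = {e} \<Longrightarrow> edges_from C (Some v) = {} \<Longrightarrow>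
     der bar C (At a e) [v] Tt"
  by (rule der_atomic) (auto simp: step_at_def intro: atomic_ax.intros)

lemma der_contraction:
  "af_lbl C v = Cv \<Longrightarrow> edges_to C (Some v) = {e, e'} \<Longrightarrow> edges_from C (Some v) = {d} \<Longrightarrow>
     der bar C (Or (At a e) (At a e')) [v] (At a d)"
  by (rule der_atomic) (auto simp: step_at_def intro: atomic_ax.intros)

lemma der_cocontraction:
  "af_lbl C v = CoCv \<Longrightarrow> edges_to C (Some v) = {d} \<Longrightarrow> edges_from C (Some v) = {e, e'} \<Longrightarrow> e \<noteq> e' \<Longrightarrow>
     der bar C (At a d) [v] (And (At a e) (At a e'))"
  by (rule der_atomic) (auto simp: step_at_def intro: atomic_ax.intros)

section \<open>Shape of an atomic step at a vertex with known edges\<close>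

lemma step_at_weakening:
  assumes "step_at bar C v x y" "af_lbl C v = Wv" "edges_from C (Some v) = {e}"
  obtains a where "x = Ff" "y = At a e"
  using assms by (auto simp: step_at_def elim!: atomic_ax.cases)

lemma step_at_coweakening:
  assumes "step_at bar C v x y" "af_lbl C v = CoWv" "edges_to C (Some v) = {e}"
  obtains a where "x = At a e" "y = Tt"
  using assms by (auto simp: step_at_def elim!: atomic_ax.cases)

text \<open>The two cases reflect that the flow fixes the pair of edges but not their order in the
  formula; a commutativity step absorbs the difference later.\<close>

lemma step_at_contraction:
  assumes "step_at bar C v x y" "af_lbl C v = Cv"
    "edges_to C (Some v) = {e, e'}" "edges_from C (Some v) = {d}"
  obtains a where "x = Or (At a e) (At a e') \<or> x = Or (At a e') (At a e)" "y = At a d"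
  using assms by (auto simp: step_at_def doubleton_eq_iff elim!: atomic_ax.cases)

lemma step_at_cocontraction:
  assumes "step_at bar C v x y" "af_lbl C v = CoCv"
    "edges_to C (Some v) = {d}" "edges_from C (Some v) = {e, e'}"
  obtains a where "x = At a d" "y = And (At a e) (At a e') \<or> y = And (At a e') (At a e)"
  using assms by (auto simp: step_at_def doubleton_eq_iff elim!: atomic_ax.cases)

text \<open>The flow does not tell which edge carries the atom and which its dual. As
  \<open>bar\<close> is an involution, choosing \<open>bar a\<close> for \<open>a\<close> if
  necessary lets \<open>e\<close> always carry the atom called \<open>a\<close>.\<close>

lemma step_at_interaction:
  assumes "step_at bar C v x y" "af_lbl C v = Iv" "edges_from C (Some v) = {e, e'}"
    and "\<forall>a. bar (bar a) = a"
  obtains a where "x = Tt" "y = Or (At a e) (At (bar a) e') \<or> y = Or (At (bar a) e') (At a e)"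
proof -
  obtain a d d' where y: "x = Tt" "y = Or (At a d) (At (bar a) d')" "{d, d'} = {e, e'}"
    using assms(1-3) by (auto simp: step_at_def elim!: atomic_ax.cases)
  then show ?thesis
    using that[of a] that[of "bar a"] assms(4) by (auto simp: doubleton_eq_iff)
qed

lemma step_at_cut:
  assumes "step_at bar C v x y" "af_lbl C v = Cutv" "edges_to C (Some v) = {e, e'}"
    and "\<forall>a. bar (bar a) = a"
  obtains a where "y = Ff" "x = And (At a e) (At (bar a) e') \<or> x = And (At (bar a) e') (At a e)"
proof -
  obtain a d d' where y: "y = Ff" "x = And (At a d) (At (bar a) d')" "{d, d'} = {e, e'}"
    using assms(1-3) by (auto simp: step_at_def elim!: atomic_ax.cases)
  then show ?thesis
    using that[of a] that[of "bar a"] assms(4) by (auto simp: doubleton_eq_iff)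
qed

section \<open>The reduction rules\<close>

lemma realizable_WdIu:
  fixes C D :: "('v, 'e) aflow" and bar :: "'a \<Rightarrow> 'a"
  assumes bar: "\<forall>a. bar (bar a) = a" and red: "reduces WdIu C D" and real: "realizable bar C P Q"
  shows "realizable bar D P Q"
proof -
  from red obtain w u \<epsilon> \<epsilon>1 R where fl: "atomic_flow C"
    and v: "w \<in> af_verts C" "af_lbl C w = Wv" "u \<in> af_verts C" "af_lbl C u = Cutv"
    and e: "\<epsilon> \<in> af_edges C" "af_up C \<epsilon> = Some w" "af_lo C \<epsilon> = Some u"
      "\<epsilon>1 \<in> af_edges C" "\<epsilon>1 \<noteq> \<epsilon>" "af_lo C \<epsilon>1 = Some u"
    and R: "R = replace C {w, u} {\<epsilon>} (\<lambda>_. CoWv) 1 0 noedge noedge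
                    (\<lambda>_. None) (\<lambda>_. Some (Inr 0))"
    and iso: "flow_iso R D"
    by auto
  note ed = weakening_edges[OF fl v(1,2) e(1,2)]
    cut_edges[OF fl v(3,4) e(1,3,4,6) e(5)[symmetric]]
  define f where "f = (\<lambda>(b :: 'a) e. if e = \<epsilon> then Ff else At b (Inl e :: 'e + nat))"
  have new: "edges_to R (Some (Inr 0)) = {Inl \<epsilon>1}" "edges_from R (Some (Inr 0)) = {}"
    "af_lbl R (Inr 0) = CoWv"
    using e by (auto simp: R edges_at_replace_new ed) (simp add: replace_def)
  have "realizable bar R P Q"
  \<comment> \<open>The weakening step shrinks to \<open>Ff\<close>, so the new coweakening belongs
    to the repaired cut: it turns the partner atom into \<open>Tt\<close>, and
    \<open>And Ff Tt\<close> equals the \<open>Ff\<close> that the cut has to deliver.\<close>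
  proof (rule realizable_replace[OF real v(1,3) _ e(2,3) R _ _ _ f_def, where ps = "[]" and qs = "[Inr 0]"])
    fix x y assume "step_at bar C w x y"
    then show "der bar R (lsubst f x) [] (lsubst f y)"
      by (rule step_at_weakening[OF _ v(2) ed(2)]) (simp add: f_def der_refl)
  next
    fix x y assume "step_at bar C u x y"
    then obtain a where y: "y = Ff"
      and x: "x = And (At a \<epsilon>) (At (bar a) \<epsilon>1) \<or> x = And (At (bar a) \<epsilon>1) (At a \<epsilon>)"
      by (rule step_at_cut[OF _ v(4) ed(3) bar])
    let ?A = "At (bar a) (Inl \<epsilon>1)"
    have "der bar R (lsubst f x) [] (And Ff ?A)"
      using x e(5) by (auto simp: f_def der_refl der_And_comm)
    also have "der bar R \<dots> [Inr 0] (And Ff Tt)"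
      by (rule der_AndR, rule der_coweakening) (use new in auto)
    also have "der bar R \<dots> [] Ff" by (rule der_And_Tt)
    finally show "der bar R (lsubst f x) [Inr 0] (lsubst f y)" by (simp add: y)
  qed (use v ed in auto)
  then show ?thesis using iso by (rule realizable_iso)
qed

lemma realizable_IdWu:
  fixes C D :: "('v, 'e) aflow" and bar :: "'a \<Rightarrow> 'a"
  assumes bar: "\<forall>a. bar (bar a) = a" and red: "reduces IdWu C D" and real: "realizable bar C P Q"
  shows "realizable bar D P Q"
proof -
  from red obtain i k \<epsilon> \<epsilon>1 R where fl: "atomic_flow C"
    and v: "i \<in> af_verts C" "af_lbl C i = Iv" "k \<in> af_verts C" "af_lbl C k = CoWv"
    and e: "\<epsilon> \<in> af_edges C" "af_up C \<epsilon> = Some i" "af_lo C \<epsilon> = Some k"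
      "\<epsilon>1 \<in> af_edges C" "\<epsilon>1 \<noteq> \<epsilon>" "af_up C \<epsilon>1 = Some i"
    and R: "R = replace C {i, k} {\<epsilon>} (\<lambda>_. Wv) 1 0 noedge noedge
                    (\<lambda>_. Some (Inr 0)) (\<lambda>_. None)"
    and iso: "flow_iso R D"
    by auto
  note ed = coweakening_edges[OF fl v(3,4) e(1,3)]
    interaction_edges[OF fl v(1,2) e(1,2,4,6) e(5)[symmetric]]
  define f where "f = (\<lambda>(b :: 'a) e. if e = \<epsilon> then Tt else At b (Inl e :: 'e + nat))"
  have new: "edges_to R (Some (Inr 0)) = {}" "edges_from R (Some (Inr 0)) = {Inl \<epsilon>1}"
    "af_lbl R (Inr 0) = Wv"
    using e by (auto simp: R edges_at_replace_new ed) (simp add: replace_def)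
  have "realizable bar R P Q"
  proof (rule realizable_replace[OF real v(1,3) _ e(2,3) R _ _ _ f_def, where ps = "[Inr 0]" and qs = "[]"])
    fix x y assume "step_at bar C k x y"
    then show "der bar R (lsubst f x) [] (lsubst f y)"
      by (rule step_at_coweakening[OF _ v(4) ed(1)]) (simp add: f_def der_refl)
  next
    fix x y assume "step_at bar C i x y"
    then obtain a where x: "x = Tt"
      and y: "y = Or (At a \<epsilon>) (At (bar a) \<epsilon>1) \<or> y = Or (At (bar a) \<epsilon>1) (At a \<epsilon>)"
      by (rule step_at_interaction[OF _ v(2) ed(4) bar])
    let ?A = "At (bar a) (Inl \<epsilon>1)"
    \<comment> \<open>Padding with \<open>Ff\<close> supplies the premiss of the new weakening,
      which creates the surviving atom of the former interaction.\<close>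
    have "der bar R Tt [] (Or Tt Ff)" by (rule der_Or_Ff')
    also have "der bar R \<dots> [Inr 0] (Or Tt ?A)"
      by (rule der_OrR, rule der_weakening) (use new in auto)
    also have "der bar R \<dots> [] (lsubst f y)"
      using y e(5) by (auto simp: f_def der_refl der_Or_comm)
    finally show "der bar R (lsubst f x) [Inr 0] (lsubst f y)" by (simp add: x)
  qed (use v ed in auto)
  then show ?thesis using iso by (rule realizable_iso)
qed

lemma realizable_WdWu:
  fixes C D :: "('v, 'e) aflow" and bar :: "'a \<Rightarrow> 'a"
  assumes red: "reduces WdWu C D" and real: "realizable bar C P Q"
  shows "realizable bar D P Q"
proof -
  from red obtain w k \<epsilon> R where fl: "atomic_flow C"
    and v: "w \<in> af_verts C" "af_lbl C w = Wv" "k \<in> af_verts C" "af_lbl C k = CoWv"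
    and e: "\<epsilon> \<in> af_edges C" "af_up C \<epsilon> = Some w" "af_lo C \<epsilon> = Some k"
    and R: "R = replace C {w, k} {\<epsilon>} (\<lambda>_. Wv) 0 0 noedge noedge (\<lambda>_. None) (\<lambda>_. None)"
    and iso: "flow_iso R D"
    by auto
  note ed = weakening_edges[OF fl v(1,2) e(1,2)] coweakening_edges[OF fl v(3,4) e(1,3)]
  define f where "f = (\<lambda>(b :: 'a) e. if e = \<epsilon> then Ff else At b (Inl e :: 'e + nat))"
  have "realizable bar R P Q"
  proof (rule realizable_replace[OF real v(1,3) _ e(2,3) R _ _ _ f_def, where ps = "[]" and qs = "[]"])
    fix x y assume "step_at bar C w x y"
    then show "der bar R (lsubst f x) [] (lsubst f y)"
      by (rule step_at_weakening[OF _ v(2) ed(2)]) (simp add: f_def der_refl)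
  next
    fix x y assume "step_at bar C k x y"
    then show "der bar R (lsubst f x) [] (lsubst f y)"
      by (rule step_at_coweakening[OF _ v(4) ed(3)]) (simp add: f_def der_Ff_Tt)
  qed (use v ed in auto)
  then show ?thesis using iso by (rule realizable_iso)
qed

lemma realizable_WdCu:
  fixes C D :: "('v, 'e) aflow" and bar :: "'a \<Rightarrow> 'a"
  assumes red: "reduces WdCu C D" and real: "realizable bar C P Q"
  shows "realizable bar D P Q"
proof -
  from red obtain w cc \<epsilon> \<epsilon>1 \<epsilon>2 R where fl: "atomic_flow C"
    and v: "w \<in> af_verts C" "af_lbl C w = Wv" "cc \<in> af_verts C" "af_lbl C cc = CoCv"
    and e: "\<epsilon> \<in> af_edges C" "af_up C \<epsilon> = Some w" "af_lo C \<epsilon> = Some cc"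
    and e12: "\<epsilon>1 \<in> af_edges C" "af_up C \<epsilon>1 = Some cc"
      "\<epsilon>2 \<in> af_edges C" "af_up C \<epsilon>2 = Some cc" "\<epsilon>1 \<noteq> \<epsilon>2"
    and R: "R = replace C {w, cc} {\<epsilon>} (\<lambda>_. Wv) 2 0 noedge noedge
                    (\<lambda>e. if e = \<epsilon>1 then Some (Inr 0) else Some (Inr 1)) (\<lambda>_. None)"
    and iso: "flow_iso R D"
    by auto
  note ed = weakening_edges[OF fl v(1,2) e(1,2)] cocontraction_edges[OF fl v(3,4) e12 e(1,3)]
  have ne: "w \<noteq> cc" "\<epsilon>1 \<noteq> \<epsilon>" "\<epsilon>2 \<noteq> \<epsilon>" using v e e12 by auto
  define f where "f = (\<lambda>(b :: 'a) e. if e = \<epsilon> then Ff else At b (Inl e :: 'e + nat))"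
  have new: "edges_to R (Some (Inr 0)) = {}" "edges_from R (Some (Inr 0)) = {Inl \<epsilon>1}"
    "edges_to R (Some (Inr 1)) = {}" "edges_from R (Some (Inr 1)) = {Inl \<epsilon>2}"
    "af_lbl R (Inr 0) = Wv" "af_lbl R (Inr 1) = Wv"
    using ne e12 by (auto simp: R edges_at_replace_new ed) (simp_all add: replace_def)
  have "realizable bar R P Q"
  proof (rule realizable_replace[OF real v(1,3) _ e(2,3) R _ _ _ f_def,
        where ps = "[]" and qs = "[Inr 0, Inr 1]"])
    fix x y assume "step_at bar C w x y"
    then show "der bar R (lsubst f x) [] (lsubst f y)"
      by (rule step_at_weakening[OF _ v(2) ed(2)]) (simp add: f_def der_refl)
  next
    fix x y assume "step_at bar C cc x y"
    then obtain a where x: "x = At a \<epsilon>"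
      and y: "y = And (At a \<epsilon>1) (At a \<epsilon>2) \<or> y = And (At a \<epsilon>2) (At a \<epsilon>1)"
      by (rule step_at_cocontraction[OF _ v(4) ed(3,4)])
    let ?A1 = "At a (Inl \<epsilon>1)" and ?A2 = "At a (Inl \<epsilon>2)"
    \<comment> \<open>The equation for \<open>And Ff Ff\<close> lets one \<open>Ff\<close> feed both
      new weakenings; the dual rule uses \<open>Or Tt Tt\<close> in the same way.\<close>
    have "der bar R Ff [] (And Ff Ff)" by (rule der_And_Ff_Ff)
    also have "der bar R \<dots> [Inr 0] (And ?A1 Ff)"
      by (rule der_AndL, rule der_weakening) (use new in auto)
    also have "der bar R \<dots> [Inr 1] (And ?A1 ?A2)"
      by (rule der_AndR, rule der_weakening) (use new in auto)
    also have "der bar R \<dots> [] (lsubst f y)"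
      using y ne by (auto simp: f_def der_refl der_And_comm)
    finally show "der bar R (lsubst f x) [Inr 0, Inr 1] (lsubst f y)" by (simp add: x f_def)
  qed (use ne ed in auto)
  then show ?thesis using iso by (rule realizable_iso)
qed

lemma realizable_CdWu:
  fixes C D :: "('v, 'e) aflow" and bar :: "'a \<Rightarrow> 'a"
  assumes red: "reduces CdWu C D" and real: "realizable bar C P Q"
  shows "realizable bar D P Q"
proof -
  \<comment> \<open>The pattern of this rule lists the coweakening first, whereas
    \<open>realizable_replace\<close> expects the upper end of the edge first; the set of deleted
    vertices is reordered accordingly.\<close>
  from red obtain k c \<epsilon> \<epsilon>1 \<epsilon>2 R where fl: "atomic_flow C"
    and v: "c \<in> af_verts C" "af_lbl C c = Cv" "k \<in> af_verts C" "af_lbl C k = CoWv"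
    and e: "\<epsilon> \<in> af_edges C" "af_up C \<epsilon> = Some c" "af_lo C \<epsilon> = Some k"
    and e12: "\<epsilon>1 \<in> af_edges C" "af_lo C \<epsilon>1 = Some c"
      "\<epsilon>2 \<in> af_edges C" "af_lo C \<epsilon>2 = Some c" "\<epsilon>1 \<noteq> \<epsilon>2"
    and R: "R = replace C {c, k} {\<epsilon>} (\<lambda>_. CoWv) 2 0 noedge noedge
                    (\<lambda>_. None) (\<lambda>e. if e = \<epsilon>1 then Some (Inr 0) else Some (Inr 1))"
    and iso: "flow_iso R D"
    by (auto simp: insert_commute)
  note ed = coweakening_edges[OF fl v(3,4) e(1,3)] contraction_edges[OF fl v(1,2) e12 e(1,2)]
  have ne: "c \<noteq> k" "\<epsilon>1 \<noteq> \<epsilon>" "\<epsilon>2 \<noteq> \<epsilon>" using v e e12 by auto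
  define f where "f = (\<lambda>(b :: 'a) e. if e = \<epsilon> then Tt else At b (Inl e :: 'e + nat))"
  have new: "edges_from R (Some (Inr 0)) = {}" "edges_to R (Some (Inr 0)) = {Inl \<epsilon>1}"
    "edges_from R (Some (Inr 1)) = {}" "edges_to R (Some (Inr 1)) = {Inl \<epsilon>2}"
    "af_lbl R (Inr 0) = CoWv" "af_lbl R (Inr 1) = CoWv"
    using ne e12 by (auto simp: R edges_at_replace_new ed) (simp_all add: replace_def)
  have "realizable bar R P Q"
  proof (rule realizable_replace[OF real v(1,3) _ e(2,3) R _ _ _ f_def,
        where ps = "[Inr 0, Inr 1]" and qs = "[]"])
    fix x y assume "step_at bar C k x y"
    then show "der bar R (lsubst f x) [] (lsubst f y)"
      by (rule step_at_coweakening[OF _ v(4) ed(1)]) (simp add: f_def der_refl)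
  next
    fix x y assume "step_at bar C c x y"
    then obtain a where x: "x = Or (At a \<epsilon>1) (At a \<epsilon>2) \<or> x = Or (At a \<epsilon>2) (At a \<epsilon>1)"
      and y: "y = At a \<epsilon>"
      by (rule step_at_contraction[OF _ v(2) ed(3,4)])
    let ?A1 = "At a (Inl \<epsilon>1)" and ?A2 = "At a (Inl \<epsilon>2)"
    have "der bar R (lsubst f x) [] (Or ?A1 ?A2)"
      using x ne by (auto simp: f_def der_refl der_Or_comm)
    also have "der bar R \<dots> [Inr 0] (Or Tt ?A2)"
      by (rule der_OrL, rule der_coweakening) (use new in auto)
    also have "der bar R \<dots> [Inr 1] (Or Tt Tt)"
      by (rule der_OrR, rule der_coweakening) (use new in auto)
    also have "der bar R \<dots> [] Tt" by (rule der_Or_Tt_Tt)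
    finally show "der bar R (lsubst f x) [Inr 0, Inr 1] (lsubst f y)" by (simp add: y f_def)
  qed (use ne ed in auto)
  then show ?thesis using iso by (rule realizable_iso)
qed

section \<open>Rules that duplicate a vertex\<close>

lemma realizable_CdIu:
  fixes C D :: "('v, 'e) aflow" and bar :: "'a \<Rightarrow> 'a"
  assumes bar: "\<forall>a. bar (bar a) = a" and red: "reduces CdIu C D" and real: "realizable bar C P Q"
  shows "realizable bar D P Q"
proof -
  from red obtain c u \<epsilon> \<epsilon>1 \<epsilon>2 \<epsilon>3 R where fl: "atomic_flow C"
    and v: "c \<in> af_verts C" "af_lbl C c = Cv" "u \<in> af_verts C" "af_lbl C u = Cutv"
    and e12: "\<epsilon>1 \<in> af_edges C" "af_lo C \<epsilon>1 = Some c"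
      "\<epsilon>2 \<in> af_edges C" "af_lo C \<epsilon>2 = Some c" "\<epsilon>1 \<noteq> \<epsilon>2"
    and e: "\<epsilon> \<in> af_edges C" "af_up C \<epsilon> = Some c" "af_lo C \<epsilon> = Some u"
      "\<epsilon>3 \<in> af_edges C" "\<epsilon>3 \<noteq> \<epsilon>" "af_lo C \<epsilon>3 = Some u"
    and R: "R = replace C {c, u} {\<epsilon>}
                    (\<lambda>j. if j = 0 then CoCv else Cutv) 3 2
                    (\<lambda>_. Some (Inr 0)) (\<lambda>j. Some (Inr (Suc j)))
                    (\<lambda>_. None)
                    (\<lambda>e. if e = \<epsilon>3 then Some (Inr 0) else if e = \<epsilon>1 then Some (Inr 1)
                         else Some (Inr 2))"
    and iso: "flow_iso R D"
    by auto
  note ed = contraction_edges[OF fl v(1,2) e12 e(1,2)]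
    cut_edges[OF fl v(3,4) e(1,3,4,6) e(5)[symmetric]]
  have ne: "c \<noteq> u" "\<epsilon>1 \<noteq> \<epsilon>" "\<epsilon>2 \<noteq> \<epsilon>" "\<epsilon>3 \<noteq> \<epsilon>1" "\<epsilon>3 \<noteq> \<epsilon>2" using v e e12 by auto
  define f where "f = (\<lambda>(b :: 'a) e. if e = \<epsilon> then Or (At b (Inl \<epsilon>1)) (At b (Inl \<epsilon>2))
                             else At b (Inl e :: 'e + nat))"
  have new: "edges_to R (Some (Inr 0)) = {Inl \<epsilon>3}" "edges_from R (Some (Inr 0)) = {Inr 0, Inr 1}"
    "edges_to R (Some (Inr 1)) = {Inl \<epsilon>1, Inr 0}" "edges_from R (Some (Inr 1)) = {}"
    "edges_to R (Some (Inr 2)) = {Inl \<epsilon>2, Inr 1}" "edges_from R (Some (Inr 2)) = {}"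
    using ne e(5) e12(5) by (auto simp: R edges_at_replace_new ed)
  have lbl: "af_lbl R (Inr 0) = CoCv" "af_lbl R (Inr 1) = Cutv" "af_lbl R (Inr 2) = Cutv"
    by (simp_all add: R replace_def)
  have "realizable bar R P Q"
  \<comment> \<open>The former contraction becomes an identity or a commutation, so all new vertices
    go to the cut. The cut \<open>Inr 2\<close> precedes \<open>Inr 1\<close> because switch first
    isolates the pair on \<open>\<epsilon>2\<close>; only then does \<open>\<epsilon>1\<close> meet
    its partner.\<close>
  proof (rule realizable_replace[OF real v(1,3) _ e(2,3) R _ _ _ f_def,
        where ps = "[]" and qs = "[Inr 0, Inr 2, Inr 1]"])
    fix x y assume "step_at bar C c x y"
    then show "der bar R (lsubst f x) [] (lsubst f y)"
      by (rule step_at_contraction[OF _ v(2) ed(1,2)])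
        (use ne in \<open>auto simp: f_def der_refl der_Or_comm\<close>)
  next
    fix x y assume "step_at bar C u x y"
    then obtain a where y: "y = Ff"
      and x: "x = And (At a \<epsilon>) (At (bar a) \<epsilon>3) \<or> x = And (At (bar a) \<epsilon>3) (At a \<epsilon>)"
      by (rule step_at_cut[OF _ v(4) ed(3) bar])
    let ?A1 = "At a (Inl \<epsilon>1)" and ?A2 = "At a (Inl \<epsilon>2)" and ?B = "At (bar a) (Inl \<epsilon>3)"
    let ?D1 = "At (bar a) (Inr 0)" and ?D2 = "At (bar a) (Inr 1)"
    have "der bar R (lsubst f x) [] (And ?B (Or ?A1 ?A2))"
      using x e(5) by (auto simp: f_def der_refl der_And_comm)
    also have "der bar R \<dots> [Inr 0] (And (And ?D1 ?D2) (Or ?A1 ?A2))"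
      by (rule der_AndL, rule der_cocontraction) (use new lbl in auto)
    \<comment> \<open>Reassociating sets \<open>?D1\<close> aside, so that \<open>?D2\<close> alone
      meets the disjunction. The replacement sends new edge 0 to the cut on
      \<open>\<epsilon>1\<close> and new edge 1 to the cut on \<open>\<epsilon>2\<close>, which
      fixes the pairing.\<close>
    also have "der bar R \<dots> [] (And ?D1 (And ?D2 (Or ?A1 ?A2)))" by (rule der_And_assoc)
    also have "der bar R \<dots> [] (And ?D1 (And ?D2 (Or ?A2 ?A1)))"
      by (intro der_AndR der_Or_comm)
    also have "der bar R \<dots> [] (And ?D1 (Or (And ?D2 ?A2) ?A1))" by (intro der_AndR der_switch)
    also have "der bar R \<dots> [] (And ?D1 (Or (And ?A2 ?D2) ?A1))"
      by (intro der_AndR der_OrL der_And_comm)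
    also have "der bar R \<dots> [Inr 2] (And ?D1 (Or Ff ?A1))"
      by (intro der_AndR der_OrL der_cut new lbl)
    also have "der bar R \<dots> [] (And ?D1 (Or ?A1 Ff))" by (intro der_AndR der_Or_comm)
    also have "der bar R \<dots> [] (And ?D1 ?A1)" by (intro der_AndR der_Or_Ff)
    also have "der bar R \<dots> [] (And ?A1 ?D1)" by (rule der_And_comm)
    also have "der bar R \<dots> [Inr 1] Ff" by (intro der_cut new lbl)
    finally show "der bar R (lsubst f x) [Inr 0, Inr 2, Inr 1] (lsubst f y)" by (simp add: y)
  qed (use ne ed in \<open>auto simp: numeral_3_eq_3 lessThan_Suc\<close>)
  then show ?thesis using iso by (rule realizable_iso)
qed

lemma realizable_IdCu:
  fixes C D :: "('v, 'e) aflow" and bar :: "'a \<Rightarrow> 'a"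
  assumes bar: "\<forall>a. bar (bar a) = a" and red: "reduces IdCu C D" and real: "realizable bar C P Q"
  shows "realizable bar D P Q"
proof -
  from red obtain i cc \<epsilon>1 \<epsilon>2 \<epsilon>3 \<epsilon> R where fl: "atomic_flow C"
    and v: "i \<in> af_verts C" "af_lbl C i = Iv" "cc \<in> af_verts C" "af_lbl C cc = CoCv"
    and e: "\<epsilon>3 \<in> af_edges C" "af_up C \<epsilon>3 = Some i"
      "\<epsilon> \<in> af_edges C" "af_up C \<epsilon> = Some i" "\<epsilon>3 \<noteq> \<epsilon>" "af_lo C \<epsilon> = Some cc"
    and e12: "\<epsilon>1 \<in> af_edges C" "af_up C \<epsilon>1 = Some cc"
      "\<epsilon>2 \<in> af_edges C" "af_up C \<epsilon>2 = Some cc" "\<epsilon>1 \<noteq> \<epsilon>2"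
    and R: "R = replace C {i, cc} {\<epsilon>}
                    (\<lambda>j. if j = 0 then Cv else Iv) 3 2
                    (\<lambda>j. Some (Inr (Suc j))) (\<lambda>_. Some (Inr 0))
                    (\<lambda>e. if e = \<epsilon>3 then Some (Inr 0) else if e = \<epsilon>1 then Some (Inr 1)
                         else Some (Inr 2))
                    (\<lambda>_. None)"
    and iso: "flow_iso R D"
    by auto
  note ed = cocontraction_edges[OF fl v(3,4) e12 e(3,6)]
    interaction_edges[OF fl v(1,2) e(3,4,1,2) e(5)[symmetric]]
  have ne: "i \<noteq> cc" "\<epsilon>1 \<noteq> \<epsilon>" "\<epsilon>2 \<noteq> \<epsilon>" "\<epsilon>3 \<noteq> \<epsilon>1" "\<epsilon>3 \<noteq> \<epsilon>2" using v e e12 by auto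
  define f where "f = (\<lambda>(b :: 'a) e. if e = \<epsilon> then And (At b (Inl \<epsilon>1)) (At b (Inl \<epsilon>2))
                             else At b (Inl e :: 'e + nat))"
  have new: "edges_from R (Some (Inr 0)) = {Inl \<epsilon>3}" "edges_to R (Some (Inr 0)) = {Inr 1, Inr 0}"
    "edges_from R (Some (Inr 1)) = {Inl \<epsilon>1, Inr 0}" "edges_to R (Some (Inr 1)) = {}"
    "edges_from R (Some (Inr 2)) = {Inl \<epsilon>2, Inr 1}" "edges_to R (Some (Inr 2)) = {}"
    using ne e(5) e12(5) by (auto simp: R edges_at_replace_new ed)
  have lbl: "af_lbl R (Inr 0) = Cv" "af_lbl R (Inr 1) = Iv" "af_lbl R (Inr 2) = Iv"
    by (simp_all add: R replace_def)
  have "realizable bar R P Q"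
  proof (rule realizable_replace[OF real v(1,3) _ e(4,6) R _ _ _ f_def,
        where ps = "[Inr 1, Inr 2, Inr 0]" and qs = "[]"])
    fix x y assume "step_at bar C cc x y"
    then show "der bar R (lsubst f x) [] (lsubst f y)"
      by (rule step_at_cocontraction[OF _ v(4) ed(1,2)])
        (use ne in \<open>auto simp: f_def der_refl der_And_comm\<close>)
  next
    fix x y assume "step_at bar C i x y"
    then obtain a where x: "x = Tt"
      and y: "y = Or (At a \<epsilon>) (At (bar a) \<epsilon>3) \<or> y = Or (At (bar a) \<epsilon>3) (At a \<epsilon>)"
      by (rule step_at_interaction[OF _ v(2) ed(4) bar])
    let ?A1 = "At a (Inl \<epsilon>1)" and ?A2 = "At a (Inl \<epsilon>2)" and ?B = "At (bar a) (Inl \<epsilon>3)"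
    let ?D1 = "At (bar a) (Inr 0)" and ?D2 = "At (bar a) (Inr 1)"
    have "der bar R Tt [Inr 1] (Or ?A1 ?D1)" by (intro der_interaction new lbl) simp
    \<comment> \<open>A unit next to \<open>?A1\<close> makes room for the second interaction inside
      the conjunction; switch then expels \<open>?D2\<close>, leaving exactly the conjunction that
      replaced \<open>\<epsilon>\<close>. The contraction comes last, as it consumes both dual
      atoms.\<close>
    also have "der bar R \<dots> [] (Or (And ?A1 Tt) ?D1)" by (intro der_OrL der_And_Tt')
    also have "der bar R \<dots> [Inr 2] (Or (And ?A1 (Or ?A2 ?D2)) ?D1)"
      by (intro der_OrL der_AndR der_interaction new lbl) simp
    also have "der bar R \<dots> [] (Or (Or (And ?A1 ?A2) ?D2) ?D1)" by (intro der_OrL der_switch)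
    also have "der bar R \<dots> [] (Or (And ?A1 ?A2) (Or ?D2 ?D1))" by (rule der_Or_assoc)
    also have "der bar R \<dots> [Inr 0] (Or (And ?A1 ?A2) ?B)"
      by (intro der_OrR der_contraction new lbl)
    also have "der bar R \<dots> [] (lsubst f y)"
      using y e(5) by (auto simp: f_def der_refl der_Or_comm)
    finally show "der bar R (lsubst f x) [Inr 1, Inr 2, Inr 0] (lsubst f y)" by (simp add: x)
  qed (use ne ed in \<open>auto simp: numeral_3_eq_3 lessThan_Suc\<close>)
  then show ?thesis using iso by (rule realizable_iso)
qed

lemma realizable_CdCu:
  fixes C D :: "('v, 'e) aflow" and bar :: "'a \<Rightarrow> 'a"
  assumes red: "reduces CdCu C D" and real: "realizable bar C P Q"
  shows "realizable bar D P Q"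
proof -
  from red obtain c cc \<epsilon> \<epsilon>1 \<epsilon>2 \<epsilon>3 \<epsilon>4 R where fl: "atomic_flow C"
    and v: "c \<in> af_verts C" "af_lbl C c = Cv" "cc \<in> af_verts C" "af_lbl C cc = CoCv"
    and e12: "\<epsilon>1 \<in> af_edges C" "af_lo C \<epsilon>1 = Some c"
      "\<epsilon>2 \<in> af_edges C" "af_lo C \<epsilon>2 = Some c" "\<epsilon>1 \<noteq> \<epsilon>2"
    and e: "\<epsilon> \<in> af_edges C" "af_up C \<epsilon> = Some c" "af_lo C \<epsilon> = Some cc"
    and e34: "\<epsilon>3 \<in> af_edges C" "af_up C \<epsilon>3 = Some cc"
      "\<epsilon>4 \<in> af_edges C" "af_up C \<epsilon>4 = Some cc" "\<epsilon>3 \<noteq> \<epsilon>4"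
    and R: "R = replace C {c, cc} {\<epsilon>}
                    (\<lambda>j. if j < 2 then CoCv else Cv) 4 4
                    (\<lambda>j. Some (Inr (j div 2))) (\<lambda>j. Some (Inr (2 + j mod 2)))
                    (\<lambda>e. if e = \<epsilon>3 then Some (Inr 2) else Some (Inr 3))
                    (\<lambda>e. if e = \<epsilon>1 then Some (Inr 0) else Some (Inr 1))"
    and iso: "flow_iso R D"
    by auto
  note ed = contraction_edges[OF fl v(1,2) e12 e(1,2)] cocontraction_edges[OF fl v(3,4) e34 e(1,3)]
  have ne: "c \<noteq> cc" "\<epsilon>1 \<noteq> \<epsilon>" "\<epsilon>2 \<noteq> \<epsilon>" "\<epsilon>3 \<noteq> \<epsilon>" "\<epsilon>4 \<noteq> \<epsilon>" using v e e12 e34 by auto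
  have four: "{..<4} = {0, 1, 2, 3 :: nat}" by auto
  define f where "f = (\<lambda>(b :: 'a) e. if e = \<epsilon> then Or (At b (Inl \<epsilon>1)) (At b (Inl \<epsilon>2))
                             else At b (Inl e :: 'e + nat))"
  have new: "edges_to R (Some (Inr 0)) = {Inl \<epsilon>1}" "edges_from R (Some (Inr 0)) = {Inr 0, Inr 1}"
    "edges_to R (Some (Inr 1)) = {Inl \<epsilon>2}" "edges_from R (Some (Inr 1)) = {Inr 2, Inr 3}"
    "edges_to R (Some (Inr 2)) = {Inr 0, Inr 2}" "edges_from R (Some (Inr 2)) = {Inl \<epsilon>3}"
    "edges_to R (Some (Inr 3)) = {Inr 1, Inr 3}" "edges_from R (Some (Inr 3)) = {Inl \<epsilon>4}"
    unfolding R edges_at_replace_new four using ne e12(5) e34(5) by (auto simp: ed)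
  have lbl: "af_lbl R (Inr 0) = CoCv" "af_lbl R (Inr 1) = CoCv"
    "af_lbl R (Inr 2) = Cv" "af_lbl R (Inr 3) = Cv"
    by (simp_all add: R replace_def)
  have "realizable bar R P Q"
  proof (rule realizable_replace[OF real v(1,3) _ e(2,3) R _ _ _ f_def,
        where ps = "[]" and qs = "[Inr 0, Inr 1, Inr 2, Inr 3]"])
    fix x y assume "step_at bar C c x y"
    then show "der bar R (lsubst f x) [] (lsubst f y)"
      by (rule step_at_contraction[OF _ v(2) ed(1,2)])
        (use ne in \<open>auto simp: f_def der_refl der_Or_comm\<close>)
  next
    fix x y assume "step_at bar C cc x y"
    then obtain a where x: "x = At a \<epsilon>"
      and y: "y = And (At a \<epsilon>3) (At a \<epsilon>4) \<or> y = And (At a \<epsilon>4) (At a \<epsilon>3)"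
      by (rule step_at_cocontraction[OF _ v(4) ed(3,4)])
    let ?A = "\<lambda>e. At a (Inl e)" and ?N = "\<lambda>j. At a (Inr j)"
    have "der bar R (Or (?A \<epsilon>1) (?A \<epsilon>2)) [Inr 0] (Or (And (?N 0) (?N 1)) (?A \<epsilon>2))"
      by (intro der_OrL der_cocontraction new lbl) simp
    also have "der bar R \<dots> [Inr 1] (Or (And (?N 0) (?N 1)) (And (?N 2) (?N 3)))"
      by (intro der_OrR der_cocontraction new lbl) simp
    \<comment> \<open>Medial is precisely the crossing of the four new edges: edge \<open>j\<close>
      leaves cocontraction \<open>j div 2\<close> and enters contraction \<open>2 + j mod 2\<close>,
      so grouping by quotient turns into grouping by parity.\<close>
    also have "der bar R \<dots> [] (And (Or (?N 0) (?N 2)) (Or (?N 1) (?N 3)))" by (rule der_medial)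
    also have "der bar R \<dots> [Inr 2] (And (?A \<epsilon>3) (Or (?N 1) (?N 3)))"
      by (intro der_AndL der_contraction new lbl)
    also have "der bar R \<dots> [Inr 3] (And (?A \<epsilon>3) (?A \<epsilon>4))"
      by (intro der_AndR der_contraction new lbl)
    also have "der bar R \<dots> [] (lsubst f y)"
      using y ne by (auto simp: f_def der_refl der_And_comm)
    finally show "der bar R (lsubst f x) [Inr 0, Inr 1, Inr 2, Inr 3] (lsubst f y)"
      by (simp add: x f_def)
  next
    fix j :: nat assume "j < 4"
    then have "j div 2 < 4" "2 + j mod 2 < 4" by auto
    then show "Some (Inr (j div 2)) \<in> Some ` Inr ` {..<4} \<and>
        Some (Inr (2 + j mod 2)) \<in> Some ` Inr ` {..<4}" by auto
  qed (use ne ed in \<open>auto simp: four\<close>)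
  then show ?thesis using iso by (rule realizable_iso)
qed

section \<open>Rules that merge two edges into one\<close>

lemma image_merge_unaffected:
  assumes "l d \<noteq> x" "l c \<noteq> x"
  shows "(\<lambda>e. Inl (if e = c then b else e)) ` {e \<in> E. l e = x} = Inl ` {e \<in> E - {d, c}. l e = x}"
  using assms by (auto simp: image_iff)

text \<open>Here \<open>d\<close> is deleted and \<open>c\<close> is absorbed by \<open>b\<close>,
  which inherits the end point of \<open>c\<close>. The old end of \<open>b\<close> is a vertex of
  the pattern, hence not \<open>x\<close>, so \<open>b\<close> is incident to \<open>x\<close>
  afterwards exactly if \<open>c\<close> was before.\<close>

lemma image_merge:
  assumes "l d \<noteq> x" "l b \<noteq> x" "b \<in> E" "c \<in> E" "b \<noteq> c" "b \<noteq> d"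
  shows "(\<lambda>e. Inl (if e = c then b else e)) ` {e \<in> E. l e = x} =
           Inl ` {e \<in> E - {d, c}. (if e = b then l c else l e) = x}" (is "?f ` ?A = ?g ` ?B")
proof (intro equalityI subsetI)
  fix y assume "y \<in> ?f ` ?A"
  then obtain e where "e \<in> E" "l e = x" "y = ?f e" by auto
  then show "y \<in> ?g ` ?B" using assms by (cases "e = c") auto
next
  fix y assume "y \<in> ?g ` ?B"
  then obtain e where e: "y = Inl e" "e \<in> ?B" by auto
  show "y \<in> ?f ` ?A"
  proof (cases "e = b")
    case True
    then have "y = ?f c" "c \<in> ?A" using e assms by auto
    then show ?thesis by blast
  next
    case False
    then have "y = ?f e" "e \<in> ?A" using e by auto
    then show ?thesis by blast
  qed
qed

text \<open>\<open>realizable_replace\<close> does not fit: \<open>\<epsilon>2\<close> disappears as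
  well, and \<open>\<epsilon>1\<close> is redirected to the old lower end of
  \<open>\<epsilon>2\<close>, a retained vertex or the boundary. Instead \<open>\<epsilon>2\<close>
  is renamed to \<open>\<epsilon>1\<close> throughout, so the parts above and below the contraction
  become one edge and the contraction step becomes a unit equation.\<close>

lemma realizable_WdCd:
  fixes C D :: "('v, 'e) aflow" and bar :: "'a \<Rightarrow> 'a"
  assumes red: "reduces WdCd C D" and real: "realizable bar C P Q"
  shows "realizable bar D P Q"
proof -
  from red obtain w c \<epsilon> \<epsilon>1 \<epsilon>2 R where fl: "atomic_flow C"
    and v: "w \<in> af_verts C" "af_lbl C w = Wv" "c \<in> af_verts C" "af_lbl C c = Cv"
    and e: "\<epsilon> \<in> af_edges C" "af_up C \<epsilon> = Some w" "af_lo C \<epsilon> = Some c"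
      "\<epsilon>1 \<in> af_edges C" "\<epsilon>1 \<noteq> \<epsilon>" "af_lo C \<epsilon>1 = Some c" "\<epsilon>2 \<in> af_edges C" "af_up C \<epsilon>2 = Some c"
    and R: "R = replace C {w, c} {\<epsilon>, \<epsilon>2} (\<lambda>_. Wv) 0 0 noedge noedge
                    (\<lambda>_. None) (\<lambda>_. map_option Inl (af_lo C \<epsilon>2))"
    and iso: "flow_iso R D"
    by auto
  note ed = weakening_edges[OF fl v(1,2) e(1,2)]
    contraction_edges[OF fl v(3,4) e(1,3,4,6) e(5)[symmetric] e(7,8)]
  \<comment> \<open>Acyclicity excludes a contraction whose lower edge is its own upper edge, in
    which case there would be nothing to merge into.\<close>
  have "(c, c) \<notin> {(v, w). \<exists>e \<in> af_edges C. af_up C e = Some v \<and> af_lo C e = Some w}"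
    using fl unfolding atomic_flow_def acyclic_def by blast
  then have ne: "w \<noteq> c" "\<epsilon>2 \<noteq> \<epsilon>" "\<epsilon>2 \<noteq> \<epsilon>1" using v e by auto
  have lo2: "af_lo C \<epsilon>2 \<noteq> Some w" "af_lo C \<epsilon>2 \<noteq> Some c"
    using ed(1,3) e(7) ne by (auto simp: edges_to_def)
  have wf: "flow_wf C" using real by (rule realizable_flow_wf)
  have edges: "af_edges R = Inl ` (af_edges C - {\<epsilon>, \<epsilon>2})"
    and verts: "af_verts R = Inl ` (af_verts C - {w, c})"
    by (auto simp: R replace_def)
  have up: "af_up R (Inl e) = map_option Inl (af_up C e)" "af_up C e \<notin> {Some w, Some c}"
    if "e \<in> af_edges C - {\<epsilon>, \<epsilon>2}" for e
  proof -
    show *: "af_up C e \<notin> {Some w, Some c}" using ed(2,4) that by (auto simp: edges_from_def)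
    then show "af_up R (Inl e) = map_option Inl (af_up C e)"
      by (auto simp: R replace_def split: option.splits)
  qed
  let ?lo = "\<lambda>e. if e = \<epsilon>1 then af_lo C \<epsilon>2 else af_lo C e"
  have lo: "af_lo R (Inl e) = map_option Inl (?lo e)" "?lo e \<notin> {Some w, Some c}"
    if "e \<in> af_edges C - {\<epsilon>, \<epsilon>2}" for e
  proof -
    show *: "?lo e \<notin> {Some w, Some c}" using ed(1,3) lo2 that by (auto simp: edges_to_def)
    then show "af_lo R (Inl e) = map_option Inl (?lo e)"
      using e(6) by (auto simp: R replace_def split: option.splits)
  qed
  have wfR: "flow_wf R"
    unfolding flow_wf_def edges verts
  proof
    fix e' :: "'e + nat" assume "e' \<in> Inl ` (af_edges C - {\<epsilon>, \<epsilon>2})"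
    then obtain d where d: "e' = Inl d" "d \<in> af_edges C - {\<epsilon>, \<epsilon>2}" by auto
    have "af_up C d \<in> insert None (Some ` af_verts C)" "?lo d \<in> insert None (Some ` af_verts C)"
      using wf d e(7) by (auto simp: flow_wf_def)
    then show "af_up R e' \<in> insert None (Some ` Inl ` (af_verts C - {w, c})) \<and>
        af_lo R e' \<in> insert None (Some ` Inl ` (af_verts C - {w, c}))"
      using up[OF d(2)] lo[OF d(2)] unfolding d(1)
      by (cases "af_up C d"; cases "?lo d") auto
  qed
  \<comment> \<open>Although \<open>g\<close> identifies \<open>\<epsilon>1\<close> and
    \<open>\<epsilon>2\<close>, the latter starts at the deleted contraction; so \<open>g\<close> is
    injective on the edges starting at any retained vertex or in the premiss.\<close>
  define g where "g = (\<lambda>e. Inl (if e = \<epsilon>2 then \<epsilon>1 else e) :: 'e + nat)"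
  define f where "f = (\<lambda>(b :: 'a) e. if e = \<epsilon> then Ff else At b (g e))"
  define T where "T = (\<lambda>v. if v \<in> {w, c} then [] else [Inl v :: 'v + nat])"
  have "realizable bar R P Q"
  proof (rule realizable_lsubst[OF real wfR, where S = "{w, c}" and h = Inl and g = g and f = f and T = T])
    fix x assume x: "x \<in> insert None (Some ` (af_verts C - {w, c}))"
    have inj: "map_option Inl y = (map_option Inl x :: ('v + nat) option) \<longleftrightarrow> y = x" for y
      by (cases x; cases y) auto
    have "edges_from R (map_option Inl x) = Inl ` {e \<in> af_edges C - {\<epsilon>, \<epsilon>2}. af_up C e = x}"
    proof -
      have "af_up R (Inl e) = map_option Inl x \<longleftrightarrow> af_up C e = x" if "e \<in> af_edges C - {\<epsilon>, \<epsilon>2}" for e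
        unfolding up(1)[OF that] by (rule inj)
      then show ?thesis unfolding edges_from_def edges by blast
    qed
    then have from_: "edges_from R (map_option Inl x) = g ` edges_from C x"
      unfolding g_def edges_from_def[of C] using x e by (subst image_merge_unaffected) auto
    have "edges_to R (map_option Inl x) = Inl ` {e \<in> af_edges C - {\<epsilon>, \<epsilon>2}. ?lo e = x}"
    proof -
      have "af_lo R (Inl e) = map_option Inl x \<longleftrightarrow> ?lo e = x" if "e \<in> af_edges C - {\<epsilon>, \<epsilon>2}" for e
        unfolding lo(1)[OF that] by (rule inj)
      then show ?thesis unfolding edges_to_def edges by blast
    qed
    then have to: "edges_to R (map_option Inl x) = g ` edges_to C x"
      unfolding g_def edges_to_def[of C] using x e ne by (subst image_merge[where d = \<epsilon>]) auto
    show "edges_from R (map_option Inl x) = g ` edges_from C x \<and>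
        edges_to R (map_option Inl x) = g ` edges_to C x \<and>
        inj_on g (edges_from C x) \<and>
        (\<forall>e \<in> edges_from C x \<union> edges_to C x. \<forall>b. f b e = At b (g e))"
      using from_ to x e by (auto simp: edges_from_def edges_to_def inj_on_def f_def g_def)
  next
    fix v x y assume "v \<in> af_verts C \<inter> {w, c}" and st: "step_at bar C v x y"
    then consider "v = w" | "v = c" by auto
    then show "der bar R (lsubst f x) (T v) (lsubst f y)"
    proof cases
      case 1
      with st obtain a where "x = Ff" "y = At a \<epsilon>"
        using step_at_weakening[OF _ v(2) ed(2)] by blast
      then show ?thesis using 1 by (simp add: f_def T_def der_refl)
    next
      case 2
      with st obtain a where x: "x = Or (At a \<epsilon>) (At a \<epsilon>1) \<or> x = Or (At a \<epsilon>1) (At a \<epsilon>)"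
        and y: "y = At a \<epsilon>2"
        using step_at_contraction[OF _ v(4) ed(3,4)] by blast
      have "der bar R (lsubst f x) [] (Or (At a (Inl \<epsilon>1)) Ff)"
        using x e(5) ne by (auto simp: f_def g_def der_refl der_Or_comm)
      also have "der bar R \<dots> [] (At a (Inl \<epsilon>1))" by (rule der_Or_Ff)
      finally show ?thesis using 2 ne y by (simp add: f_def g_def T_def)
    qed
  qed (auto simp: T_def R replace_def split: if_splits)
  then show ?thesis using iso by (rule realizable_iso)
qed

text \<open>Dual to the previous rule: the merged edge keeps the name of its lower part
  \<open>\<epsilon>1\<close> and takes the upper end of \<open>\<epsilon>2\<close>.\<close>

lemma realizable_CuWu:
  fixes C D :: "('v, 'e) aflow" and bar :: "'a \<Rightarrow> 'a"
  assumes red: "reduces CuWu C D" and real: "realizable bar C P Q"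
  shows "realizable bar D P Q"
proof -
  from red obtain k cc \<epsilon> \<epsilon>1 \<epsilon>2 R where fl: "atomic_flow C"
    and v: "k \<in> af_verts C" "af_lbl C k = CoWv" "cc \<in> af_verts C" "af_lbl C cc = CoCv"
    and e: "\<epsilon> \<in> af_edges C" "af_up C \<epsilon> = Some cc" "af_lo C \<epsilon> = Some k"
      "\<epsilon>1 \<in> af_edges C" "\<epsilon>1 \<noteq> \<epsilon>" "af_up C \<epsilon>1 = Some cc" "\<epsilon>2 \<in> af_edges C" "af_lo C \<epsilon>2 = Some cc"
    and R: "R = replace C {k, cc} {\<epsilon>, \<epsilon>2} (\<lambda>_. Wv) 0 0 noedge noedge
                    (\<lambda>_. map_option Inl (af_up C \<epsilon>2)) (\<lambda>_. None)"
    and iso: "flow_iso R D"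
    by auto
  note ed = coweakening_edges[OF fl v(1,2) e(1,3)]
    cocontraction_edges[OF fl v(3,4) e(1,2,4,6) e(5)[symmetric] e(7,8)]
  have "(cc, cc) \<notin> {(v, w). \<exists>e \<in> af_edges C. af_up C e = Some v \<and> af_lo C e = Some w}"
    using fl unfolding atomic_flow_def acyclic_def by blast
  then have ne: "k \<noteq> cc" "\<epsilon>2 \<noteq> \<epsilon>" "\<epsilon>2 \<noteq> \<epsilon>1" using v e by auto
  have up2: "af_up C \<epsilon>2 \<noteq> Some k" "af_up C \<epsilon>2 \<noteq> Some cc"
    using ed(2,4) e(7) ne by (auto simp: edges_from_def)
  have wf: "flow_wf C" using real by (rule realizable_flow_wf)
  have edges: "af_edges R = Inl ` (af_edges C - {\<epsilon>, \<epsilon>2})"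
    and verts: "af_verts R = Inl ` (af_verts C - {k, cc})"
    by (auto simp: R replace_def)
  have lo: "af_lo R (Inl e) = map_option Inl (af_lo C e)" "af_lo C e \<notin> {Some k, Some cc}"
    if "e \<in> af_edges C - {\<epsilon>, \<epsilon>2}" for e
  proof -
    show *: "af_lo C e \<notin> {Some k, Some cc}" using ed(1,3) that by (auto simp: edges_to_def)
    then show "af_lo R (Inl e) = map_option Inl (af_lo C e)"
      by (auto simp: R replace_def split: option.splits)
  qed
  let ?up = "\<lambda>e. if e = \<epsilon>1 then af_up C \<epsilon>2 else af_up C e"
  have up: "af_up R (Inl e) = map_option Inl (?up e)" "?up e \<notin> {Some k, Some cc}"
    if "e \<in> af_edges C - {\<epsilon>, \<epsilon>2}" for e
  proof -
    show *: "?up e \<notin> {Some k, Some cc}" using ed(2,4) up2 that by (auto simp: edges_from_def)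
    then show "af_up R (Inl e) = map_option Inl (?up e)"
      using e(6) by (auto simp: R replace_def split: option.splits)
  qed
  have wfR: "flow_wf R"
    unfolding flow_wf_def edges verts
  proof
    fix e' :: "'e + nat" assume "e' \<in> Inl ` (af_edges C - {\<epsilon>, \<epsilon>2})"
    then obtain d where d: "e' = Inl d" "d \<in> af_edges C - {\<epsilon>, \<epsilon>2}" by auto
    have "af_lo C d \<in> insert None (Some ` af_verts C)" "?up d \<in> insert None (Some ` af_verts C)"
      using wf d e(7) by (auto simp: flow_wf_def)
    then show "af_up R e' \<in> insert None (Some ` Inl ` (af_verts C - {k, cc})) \<and>
        af_lo R e' \<in> insert None (Some ` Inl ` (af_verts C - {k, cc}))"
      using up[OF d(2)] lo[OF d(2)] unfolding d(1)
      by (cases "af_lo C d"; cases "?up d") auto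
  qed
  \<comment> \<open>This time \<open>\<epsilon>1\<close> is the one that starts at a deleted vertex,
    which again gives injectivity on edges with a retained origin.\<close>
  define g where "g = (\<lambda>e. Inl (if e = \<epsilon>2 then \<epsilon>1 else e) :: 'e + nat)"
  define f where "f = (\<lambda>(b :: 'a) e. if e = \<epsilon> then Tt else At b (g e))"
  define T where "T = (\<lambda>v. if v \<in> {k, cc} then [] else [Inl v :: 'v + nat])"
  have "realizable bar R P Q"
  proof (rule realizable_lsubst[OF real wfR, where S = "{k, cc}" and h = Inl and g = g and f = f and T = T])
    fix x assume x: "x \<in> insert None (Some ` (af_verts C - {k, cc}))"
    have inj: "map_option Inl y = (map_option Inl x :: ('v + nat) option) \<longleftrightarrow> y = x" for y
      by (cases x; cases y) auto
    have "edges_from R (map_option Inl x) = Inl ` {e \<in> af_edges C - {\<epsilon>, \<epsilon>2}. ?up e = x}"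
    proof -
      have "af_up R (Inl e) = map_option Inl x \<longleftrightarrow> ?up e = x" if "e \<in> af_edges C - {\<epsilon>, \<epsilon>2}" for e
        unfolding up(1)[OF that] by (rule inj)
      then show ?thesis unfolding edges_from_def edges by blast
    qed
    then have from_: "edges_from R (map_option Inl x) = g ` edges_from C x"
      unfolding g_def edges_from_def[of C] using x e ne by (subst image_merge[where d = \<epsilon>]) auto
    have "edges_to R (map_option Inl x) = Inl ` {e \<in> af_edges C - {\<epsilon>, \<epsilon>2}. af_lo C e = x}"
    proof -
      have "af_lo R (Inl e) = map_option Inl x \<longleftrightarrow> af_lo C e = x" if "e \<in> af_edges C - {\<epsilon>, \<epsilon>2}" for e
        unfolding lo(1)[OF that] by (rule inj)
      then show ?thesis unfolding edges_to_def edges by blast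
    qed
    then have to: "edges_to R (map_option Inl x) = g ` edges_to C x"
      unfolding g_def edges_to_def[of C] using x e by (subst image_merge_unaffected) auto
    show "edges_from R (map_option Inl x) = g ` edges_from C x \<and>
        edges_to R (map_option Inl x) = g ` edges_to C x \<and>
        inj_on g (edges_from C x) \<and>
        (\<forall>e \<in> edges_from C x \<union> edges_to C x. \<forall>b. f b e = At b (g e))"
      using from_ to x e by (auto simp: edges_from_def edges_to_def inj_on_def f_def g_def)
  next
    fix v x y assume "v \<in> af_verts C \<inter> {k, cc}" and st: "step_at bar C v x y"
    then consider "v = k" | "v = cc" by auto
    then show "der bar R (lsubst f x) (T v) (lsubst f y)"
    proof cases
      case 1
      with st obtain a where "x = At a \<epsilon>" "y = Tt"
        using step_at_coweakening[OF _ v(2) ed(1)] by blast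
      then show ?thesis using 1 by (simp add: f_def T_def der_refl)
    next
      case 2
      with st obtain a where x: "x = At a \<epsilon>2"
        and y: "y = And (At a \<epsilon>) (At a \<epsilon>1) \<or> y = And (At a \<epsilon>1) (At a \<epsilon>)"
        using step_at_cocontraction[OF _ v(4) ed(3,4)] by blast
      have "der bar R (At a (Inl \<epsilon>1)) [] (And (At a (Inl \<epsilon>1)) Tt)" by (rule der_And_Tt')
      also have "der bar R \<dots> [] (lsubst f y)"
        using y e(5) ne by (auto simp: f_def g_def der_refl der_And_comm)
      finally show ?thesis using 2 ne x by (simp add: f_def g_def T_def)
    qed
  qed (auto simp: T_def R replace_def split: if_splits)
  then show ?thesis using iso by (rule realizable_iso)
qed

theorem theorem4p8:
  fixes bar :: "'a \<Rightarrow> 'a" and r :: rrule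
    and C D :: "('v, 'e) aflow" and \<Phi> :: "('a, 'l) deriv"
  assumes "\<forall>a. bar (bar a) = a" and "\<forall>a. bar a \<noteq> a"
    and "reduces r C D"
    and "is_deriv bar \<Phi>" and "flow_iso (flow_of \<Phi>) C"
  shows "\<exists>\<Psi> :: ('a, 'e) deriv. is_deriv bar \<Psi> \<and> flow_iso (flow_of \<Psi>) D \<and>
           premiss \<Psi> = premiss \<Phi> \<and> conclusion \<Psi> = conclusion \<Phi>"
proof -
  \<comment> \<open>Passing along the isomorphism renames the labels of \<open>\<Phi>\<close> to
    edges of \<open>C\<close>, so that the two steps of the pattern can be addressed by their
    vertices.\<close>
  have C: "realizable bar C (premiss \<Phi>) (conclusion \<Phi>)"
    using realizable_flow_of[OF assms(4)] assms(5) by (rule realizable_iso)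
  have "realizable bar D (premiss \<Phi>) (conclusion \<Phi>)"
  proof (cases r)
    case WdCd
    show ?thesis using assms(3) C unfolding WdCd by (rule realizable_WdCd)
  next
    case WdIu
    show ?thesis using assms(1,3) C unfolding WdIu by (rule realizable_WdIu)
  next
    case WdWu
    show ?thesis using assms(3) C unfolding WdWu by (rule realizable_WdWu)
  next
    case WdCu
    show ?thesis using assms(3) C unfolding WdCu by (rule realizable_WdCu)
  next
    case CdIu
    show ?thesis using assms(1,3) C unfolding CdIu by (rule realizable_CdIu)
  next
    case CdCu
    show ?thesis using assms(3) C unfolding CdCu by (rule realizable_CdCu)
  next
    case CuWu
    show ?thesis using assms(3) C unfolding CuWu by (rule realizable_CuWu)
  next
    case IdWu
    show ?thesis using assms(1,3) C unfolding IdWu by (rule realizable_IdWu)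
  next
    case CdWu
    show ?thesis using assms(3) C unfolding CdWu by (rule realizable_CdWu)
  next
    case IdCu
    show ?thesis using assms(1,3) C unfolding IdCu by (rule realizable_IdCu)
  qed
  then show ?thesis by (rule realizable_deriv) blast
qed

end
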